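(* For every $p\in(2,6)$ and every $\mu>0$, up to multiplication by a constant complex phase there exists a unique least energy nodal normalized solution with mass $\mu$ of the problem $$u''+|u|^{p-2}u=\lambda u\ \text{ in }(0,1),\qquad u'(0)=u'(1)=0,\qquad \|u\|_{L^2(0,1)}^2=\mu .$$
   Context: In the problem, $\lambda\in\mathbb R$ is not prescribed. Let $E_p(u)=\frac12\|u'\|_{L^2(0,1)}^2-\frac1p\|u\|_{L^p(0,1)}^p$. A least energy nodal normalized solution with mass $\mu$ is a (real-valued) sign-changing function $u$ which solves $$u''+|u|^{p-2}u=\lambda u\ \text{ in }(0,1),\qquad u'(0)=u'(1)=0,\qquad \|u\|_{L^2(0,1)}^2=\mu$$ for some $\lambda\in\mathbb R$ and satisfies $$E_p(u)=\inf\{E_p(v): v\text{ is a sign-changing function such that } v''+|v|^{p-2}v=\lambda v\text{ in }(0,1),\ v'(0)=v'(1)=0,\ \|v\|_{L^2(0,1)}^2=\mu,\text{ with the same }p\text{ and }\mu,\text{ for some }\lambda\in\mathbb R\}.$$ *)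

theory Defs
  imports "HOL-Analysis.Analysis"
begin

text \<open>
  Functions on \<open>(0,1)\<close> and \<open>[0,1]\<close> are rendered as total functions \<open>real \<Rightarrow> real\<close>. None of the
  definitions below depends on values outside \<open>[0,1]\<close>.
\<close>

definition Lp_norm :: "real \<Rightarrow> (real \<Rightarrow> real) \<Rightarrow> real" where
  "Lp_norm q u = (LINT x:{0<..<1}|lborel. \<bar>u x\<bar> powr q) powr (1 / q)"

definition energy :: "real \<Rightarrow> (real \<Rightarrow> real) \<Rightarrow> real" where
  "energy p u = 1 / 2 * (Lp_norm 2 (deriv u))\<^sup>2 - 1 / p * Lp_norm p u powr p"

text \<open>
  Classical solutions, of class \<open>C\<^sup>1\<close> on \<open>[0,1]\<close> and twice differentiable in \<open>(0,1)\<close>. The derivatives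
  at the endpoints are one-sided. Weak solutions in \<open>H\<^sup>1(0,1)\<close> are classical in this sense.
\<close>

definition neumann_solution :: "real \<Rightarrow> real \<Rightarrow> (real \<Rightarrow> real) \<Rightarrow> bool" where
  "neumann_solution p lam u \<longleftrightarrow>
     (\<exists>u' u''.
        (\<forall>x\<in>{0..1}. (u has_real_derivative u' x) (at x within {0..1})) \<and>
        continuous_on {0..1} u' \<and>
        (\<forall>x\<in>{0<..<1}. (u' has_real_derivative u'' x) (at x)) \<and>
        (\<forall>x\<in>{0<..<1}. u'' x + \<bar>u x\<bar> powr (p - 2) * u x = lam * u x) \<and>
        u' 0 = 0 \<and> u' 1 = 0)"

definition sign_changing :: "(real \<Rightarrow> real) \<Rightarrow> bool" where
  "sign_changing u \<longleftrightarrow> (\<exists>x\<in>{0<..<1}. u x > 0) \<and> (\<exists>x\<in>{0<..<1}. u x < 0)"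

definition nodal_normalized_solutions :: "real \<Rightarrow> real \<Rightarrow> (real \<Rightarrow> real) set" where
  "nodal_normalized_solutions p \<mu> =
     {u. sign_changing u \<and> (\<exists>lam. neumann_solution p lam u) \<and> (Lp_norm 2 u)\<^sup>2 = \<mu>}"

text \<open>
  The infimum is taken in the extended reals, as \<open>Inf\<close> on \<open>real\<close> is unspecified for sets that are
  not bounded below.
\<close>

definition least_energy_nodal_normalized_solution ::
    "real \<Rightarrow> real \<Rightarrow> (real \<Rightarrow> real) \<Rightarrow> bool" where
  "least_energy_nodal_normalized_solution p \<mu> u \<longleftrightarrow>
     u \<in> nodal_normalized_solutions p \<mu> \<and>
     ereal (energy p u) = (INF v\<in>nodal_normalized_solutions p \<mu>. ereal (energy p v))"

definition equal_up_to_phase :: "(real \<Rightarrow> real) \<Rightarrow> (real \<Rightarrow> real) \<Rightarrow> bool" where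
  "equal_up_to_phase u v \<longleftrightarrow>
     (\<exists>c::complex. norm c = 1 \<and> (\<forall>x\<in>{0..1}. complex_of_real (v x) = c * complex_of_real (u x)))"

end

theory Submission
  imports Defs
begin

text \<open>
  Along a solution the Hamiltonian \<open>u'^2/2 + |u|^p/p - lam u^2/2\<close> is constant, and for a sign-changing
  solution the constant \<open>h\<close> is positive, because \<open>u\<close> has a zero where \<open>u'\<close> cannot vanish. At a
  positive level all critical points of \<open>u\<close> have the same height \<open>|u|\<close>. Uniqueness for the initial
  value problem then makes \<open>u\<close> a chain of \<open>2 k\<close> copies, up to reflection and sign, of a quarter wave:
  a profile on \<open>[0, 1/(2 k)]\<close> that is positive, starts with slope \<open>0\<close> and vanishes at the right end
  (\<open>nodal_structure\<close>). Here \<open>k\<close> is the number of zeros of \<open>u\<close>.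

  Quarter waves minimize a convex functional. Take the accumulated mass \<open>s\<close>, with \<open>ds = u^2 dx\<close>, as
  the independent variable and \<open>w = u^4\<close> as the unknown. The energy becomes
  \<open>(1/32) \<integral> w_s^2 / w ds - (1/p) \<integral> w^((p-2)/4) ds\<close> and the length of the interval becomes
  \<open>\<integral> w^(-1/2) ds\<close>. The first is convex since \<open>0 < (p-2)/4 < 1\<close>, that is \<open>2 < p < 6\<close>, and the
  second is strictly convex. A solution with Hamiltonian \<open>h\<close> is a critical point of energy plus \<open>h\<close>
  times length, so \<open>h > 0\<close> makes it the only minimizer of the energy among the positive profiles with
  the same interval, the same mass and a zero at the right end (\<open>quarter_wave_comparison\<close>).

  In particular two solutions with one zero and the same mass agree up to sign. A solution with \<open>k\<close>
  zeros, stretched by the factor \<open>k\<close>, becomes a competitor for the solution with one zero: the mass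
  and the \<open>L^p\<close> norm are preserved, while the gradient term is divided by \<open>k^2\<close>. Hence solutions with
  \<open>k \<ge> 2\<close> have strictly larger energy (\<open>quarter_energy_minimal\<close>).

  It remains to find a solution with one zero and mass \<open>\<mu>\<close> (\<open>nodal_solution_exists\<close>). Writing
  \<open>u = M cos \<theta>\<close> turns the Hamiltonian identity into a first-order equation for the phase \<open>\<theta>\<close> with
  positive continuous speed, governed by the parameter \<open>\<kappa> = lam / M^(p-2) < 2/p\<close>. The requirement that
  \<open>\<theta>\<close> runs from \<open>0\<close> to \<open>\<pi>\<close> on the unit interval fixes \<open>M\<close>, and the mass is then a continuous function
  of \<open>\<kappa>\<close> with limits \<open>0\<close> at \<open>-\<infinity>\<close> and \<open>\<infinity>\<close> at \<open>2/p\<close>; the intermediate value theorem gives \<open>\<kappa>\<close>.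
\<close>

section \<open>The nonlinearity and inverses of increasing functions\<close>

lemma continuous_on_abs_powr:
  fixes f :: "'a::topological_space \<Rightarrow> real"
  assumes "continuous_on S f" "q > 0"
  shows "continuous_on S (\<lambda>x. \<bar>f x\<bar> powr q)"
  using assms by (intro continuous_on_powr' continuous_intros) auto

lemma isCont_abs_powr:
  fixes q x :: real
  assumes "q > 0"
  shows "isCont (\<lambda>x. \<bar>x\<bar> powr q) x"
  using continuous_on_abs_powr[of UNIV "\<lambda>x. x" q] assms
  by (simp add: continuous_on_eq_continuous_at)

text \<open>
  At the origin the difference quotient is \<open>|h|^(p-1)\<close> up to sign, which tends to \<open>0\<close> because \<open>p > 1\<close>.
\<close>

lemma powr_abs_deriv:
  fixes p s :: real
  assumes "p > 1"
  shows "((\<lambda>s. \<bar>s\<bar> powr p) has_real_derivative p * (\<bar>s\<bar> powr (p - 2) * s)) (at s)"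
proof (cases "s = 0")
  case True
  have "((\<lambda>h::real. \<bar>h\<bar> powr (p - 1)) \<longlongrightarrow> 0) (at 0)"
  proof -
    have "isCont (\<lambda>h::real. \<bar>h\<bar> powr (p - 1)) 0"
      using assms by (intro isCont_abs_powr) auto
    then show ?thesis using assms by (simp add: isCont_def)
  qed
  then have "((\<lambda>h::real. \<bar>h\<bar> powr p / h) \<longlongrightarrow> 0) (at 0)"
  proof (rule tendsto_rabs_zero_cancel[OF Lim_transform_eventually])
    show "\<forall>\<^sub>F h::real in at 0. \<bar>h\<bar> powr (p - 1) = \<bar>\<bar>h\<bar> powr p / h\<bar>"
      by (simp add: eventually_at_filter powr_diff)
  qed
  then show ?thesis using True assms
    by (simp add: DERIV_def)
next
  case False
  then consider "s > 0" | "s < 0" by linarith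
  then show ?thesis
  proof cases
    case 1
    have "((\<lambda>s. s powr p) has_real_derivative p * s powr (p - 1)) (at s)"
      using 1 by (rule has_real_derivative_powr)
    moreover have "p * (\<bar>s\<bar> powr (p - 2) * s) = p * s powr (p - 1)"
      using 1 powr_add[of s "p-2" 1] by (simp add: algebra_simps)
    moreover have "\<forall>\<^sub>F x in nhds s. x > 0"
      using 1 by (intro eventually_nhds_in_open[of "{0<..}", simplified]) auto
    ultimately show ?thesis
      by (subst DERIV_cong_ev[OF refl _ refl, of _ "\<lambda>s. s powr p"]) (auto elim: eventually_mono)
  next
    case 2
    have "((\<lambda>s. (- s) powr p) has_real_derivative p * (-s) powr (p - 1) * (-1)) (at s)"
      using 2 by (auto intro!: derivative_eq_intros simp: powr_diff)
    moreover have "p * (\<bar>s\<bar> powr (p - 2) * s) = p * (-s) powr (p - 1) * (-1)"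
      using 2 powr_add[of "-s" "p-2" 1] by (simp add: algebra_simps)
    moreover have "\<forall>\<^sub>F x in nhds s. x < 0"
      using 2 by (intro eventually_nhds_in_open[of "{..<0}", simplified]) auto
    ultimately show ?thesis
      by (subst DERIV_cong_ev[OF refl _ refl, of _ "\<lambda>s. (-s) powr p"]) (auto elim: eventually_mono)
  qed
qed

lemma powr_abs_times_deriv:
  fixes p s :: real
  assumes "p > 2"
  shows "((\<lambda>s. \<bar>s\<bar> powr (p - 2) * s) has_real_derivative (p - 1) * \<bar>s\<bar> powr (p - 2)) (at s)"
proof (cases "s = 0")
  case True
  have "isCont (\<lambda>h::real. \<bar>h\<bar> powr (p - 2)) 0"
    using assms by (intro isCont_abs_powr) auto
  then have "((\<lambda>h::real. \<bar>h\<bar> powr (p - 2)) \<longlongrightarrow> 0) (at 0)"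
    using assms by (simp add: isCont_def)
  then have "((\<lambda>h::real. \<bar>h\<bar> powr (p - 2) * h / h) \<longlongrightarrow> 0) (at 0)"
    by (rule Lim_transform_eventually) (simp add: eventually_at_filter)
  then show ?thesis using True assms by (simp add: DERIV_def)
next
  case False
  then consider "s > 0" | "s < 0" by linarith
  then show ?thesis
  proof cases
    case 1
    have "((\<lambda>s. s powr (p-1)) has_real_derivative (p-1) * s powr (p - 1 - 1)) (at s)"
      using 1 by (rule has_real_derivative_powr)
    moreover have "\<forall>\<^sub>F x in nhds s. x > 0"
      using 1 by (intro eventually_nhds_in_open[of "{0<..}", simplified]) auto
    moreover have "\<bar>x\<bar> powr (p-2) * x = x powr (p-1)" if "x > 0" for x
      using that powr_add[of x "p-2" 1] by (simp add: algebra_simps)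
    ultimately show ?thesis using 1
      by (subst DERIV_cong_ev[OF refl _ refl, of _ "\<lambda>s. s powr (p-1)"]) (auto elim: eventually_mono)
  next
    case 2
    have "((\<lambda>s. - ((- s) powr (p-1))) has_real_derivative (p-1) * (-s) powr (p - 2)) (at s)"
    proof -
      have "((\<lambda>s. (- s) powr (p-1)) has_real_derivative (p-1) * (-s) powr (p - 1 - 1) * (-1)) (at s)"
        using 2 by (intro DERIV_chain2[OF has_real_derivative_powr]) (auto intro!: derivative_eq_intros)
      from DERIV_minus[OF this] show ?thesis by simp
    qed
    moreover have "\<forall>\<^sub>F x in nhds s. x < 0"
      using 2 by (intro eventually_nhds_in_open[of "{..<0}", simplified]) auto
    moreover have "\<bar>x\<bar> powr (p-2) * x = - ((-x) powr (p-1))" if "x < 0" for x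
      using that powr_add[of "-x" "p-2" 1] by (simp add: algebra_simps)
    ultimately show ?thesis using 2
      by (subst DERIV_cong_ev[OF refl _ refl, of _ "\<lambda>s. - ((-s) powr (p-1))"]) (auto elim: eventually_mono)
  qed
qed

lemma nonlinearity_lipschitz:
  fixes p lam K :: real
  assumes "p > 2"
  obtains L where "L \<ge> 0"
    "\<And>x y. \<bar>x\<bar> \<le> K \<Longrightarrow> \<bar>y\<bar> \<le> K \<Longrightarrow>
       \<bar>(lam * x - \<bar>x\<bar> powr (p - 2) * x) - (lam * y - \<bar>y\<bar> powr (p - 2) * y)\<bar> \<le> L * \<bar>x - y\<bar>"
proof
  let ?f = "\<lambda>x. lam * x - \<bar>x\<bar> powr (p - 2) * x"
  let ?L = "\<bar>lam\<bar> + (p - 1) * \<bar>K\<bar> powr (p - 2)"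
  show "?L \<ge> 0" using assms by simp
  fix x y assume xy: "\<bar>x\<bar> \<le> K" "\<bar>y\<bar> \<le> K"
  have d: "(?f has_field_derivative lam - (p - 1) * \<bar>s\<bar> powr (p - 2)) (at s within {-K..K})" for s
    by (rule has_field_derivative_at_within)
       (use DERIV_diff[OF DERIV_cmult[OF DERIV_ident, of lam] powr_abs_times_deriv[OF assms, of s]] in simp)
  have b: "norm (lam - (p - 1) * \<bar>s\<bar> powr (p - 2)) \<le> ?L" if "s \<in> {-K..K}" for s
  proof -
    have "\<bar>s\<bar> powr (p - 2) \<le> \<bar>K\<bar> powr (p - 2)" using that assms by (intro powr_mono2) auto
    then have "(p - 1) * \<bar>s\<bar> powr (p - 2) \<le> (p - 1) * \<bar>K\<bar> powr (p - 2)"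
      using assms by (intro mult_left_mono) auto
    moreover have "0 \<le> (p - 1) * \<bar>s\<bar> powr (p - 2)" using assms by simp
    ultimately show ?thesis unfolding real_norm_def by linarith
  qed
  have "norm (?f x - ?f y) \<le> ?L * norm (x - y)"
    by (rule field_differentiable_bound[OF _ d b]) (use xy in auto)
  then show "\<bar>?f x - ?f y\<bar> \<le> ?L * \<bar>x - y\<bar>" by simp
qed

text \<open>
  The derivative may vanish at the end points, so the inverse is only continuous there. This is what
  happens to the mass function \<open>\<integral> u^2\<close> of a profile that vanishes at the end of its interval.
\<close>

lemma increasing_inverse:
  fixes f f' :: "real \<Rightarrow> real"
  assumes ab: "a < b" and cont: "continuous_on {a..b} f"
    and der: "\<And>x. x \<in> {a<..<b} \<Longrightarrow> (f has_real_derivative f' x) (at x)"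
    and pos: "\<And>x. x \<in> {a<..<b} \<Longrightarrow> f' x > 0"
  shows "\<exists>g. continuous_on {f a..f b} g \<and>
    (\<forall>x\<in>{a..b}. f x \<in> {f a..f b} \<and> g (f x) = x) \<and>
    (\<forall>y\<in>{f a..f b}. g y \<in> {a..b} \<and> f (g y) = y) \<and>
    (\<forall>y\<in>{f a<..<f b}. g y \<in> {a<..<b} \<and> (g has_real_derivative inverse (f' (g y))) (at y))"
proof -
  have less: "f x < f y" if "a \<le> x" "x < y" "y \<le> b" for x y
  proof (rule DERIV_pos_imp_increasing_open[OF that(2)])
    show "\<exists>z. (f has_real_derivative z) (at t) \<and> 0 < z" if "x < t" "t < y" for t
      using der[of t] pos[of t] that \<open>a \<le> x\<close> \<open>y \<le> b\<close> by auto
    show "continuous_on {x..y} f" using cont that by (auto elim: continuous_on_subset)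
  qed
  have inj: "inj_on f {a..b}"
    by (rule linorder_inj_onI) (use less in \<open>force+\<close>)
  have img: "f ` {a..b} = {f a..f b}"
  proof
    show "f ` {a..b} \<subseteq> {f a..f b}"
    proof
      fix y assume "y \<in> f ` {a..b}"
      then obtain x where x: "x \<in> {a..b}" "y = f x" by auto
      then have "f a \<le> f x" "f x \<le> f b"
        using less[of a x] less[of x b] by (cases "x = a"; cases "x = b"; force)+
      then show "y \<in> {f a..f b}" using x by auto
    qed
    show "{f a..f b} \<subseteq> f ` {a..b}"
    proof
      fix y assume y: "y \<in> {f a..f b}"
      obtain x where "a \<le> x" "x \<le> b" "f x = y"
        using IVT'[of f a y b] y ab cont by auto
      then show "y \<in> f ` {a..b}" by auto
    qed
  qed
  define g where "g = the_inv_into {a..b} f"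
  have gf: "g (f x) = x" if "x \<in> {a..b}" for x
    unfolding g_def using inj that by (rule the_inv_into_f_f)
  have gm: "g y \<in> {a..b} \<and> f (g y) = y" if "y \<in> {f a..f b}" for y
  proof -
    have "y \<in> f ` {a..b}" using that by (simp only: img)
    then obtain x where "y = f x" "x \<in> {a..b}" by (rule imageE)
    then show ?thesis using gf[of x] by simp
  qed
  have gc: "continuous_on {f a..f b} g"
    using continuous_on_inv[OF cont compact_Icc, of g] gf by (simp only: img) blast
  show ?thesis
  proof (intro exI[of _ g] conjI[OF gc] conjI ballI)
    fix y assume y: "y \<in> {f a<..<f b}"
    have gy: "g y \<in> {a<..<b}"
    proof -
      have "g y \<in> {a..b}" "f (g y) = y" using gm[of y] y by auto
      moreover have "g y \<noteq> a" "g y \<noteq> b" using gm[of y] y by auto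
      ultimately show ?thesis by auto
    qed
    have "isCont g y"
      using continuous_on_interior[OF gc, of y] y by simp
    then have "(g has_real_derivative inverse (f' (g y))) (at y)"
      using y gm by (intro DERIV_inverse_function[where f=f and a="f a" and b="f b"] der gy)
         (use pos[OF gy] in auto)
    then show "(g has_real_derivative inverse (f' (g y))) (at y)" .
    show "g y \<in> {a<..<b}" by (rule gy)
  next
    fix x assume "x \<in> {a..b}"
    then show "f x \<in> {f a..f b}" "g (f x) = x"
      using gf[of x] img by blast+
  qed (use gm in blast)+
qed


section \<open>The initial value problem\<close>

text \<open>
  The derivative \<open>u1\<close> is a parameter, so that initial data and Neumann conditions can be stated at the
  end points, where only one-sided derivatives exist.
\<close>

definition nls_on ::
    "real \<Rightarrow> real \<Rightarrow> real \<Rightarrow> real \<Rightarrow> (real \<Rightarrow> real) \<Rightarrow> (real \<Rightarrow> real) \<Rightarrow> bool" where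
  "nls_on p lam a b u u1 \<longleftrightarrow>
     (\<forall>x\<in>{a..b}. (u has_real_derivative u1 x) (at x within {a..b})) \<and>
     continuous_on {a..b} u1 \<and>
     (\<forall>x\<in>{a<..<b}. (u1 has_real_derivative lam * u x - \<bar>u x\<bar> powr (p - 2) * u x) (at x))"

lemma
  assumes "nls_on p lam a b u u1"
  shows nls_on_deriv_within:
      "x \<in> {a..b} \<Longrightarrow> (u has_real_derivative u1 x) (at x within {a..b})"
    and nls_on_cont_deriv: "continuous_on {a..b} u1"
    and nls_on_cont: "continuous_on {a..b} u"
    and nls_on_deriv: "x \<in> {a<..<b} \<Longrightarrow> (u has_real_derivative u1 x) (at x)"
    and nls_on_deriv2: "x \<in> {a<..<b} \<Longrightarrow>
      (u1 has_real_derivative lam * u x - \<bar>u x\<bar> powr (p - 2) * u x) (at x)"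
proof -
  show w: "(u has_real_derivative u1 x) (at x within {a..b})" if "x \<in> {a..b}" for x
    using assms that by (simp add: nls_on_def)
  show "continuous_on {a..b} u1"
    using assms by (simp add: nls_on_def)
  show "continuous_on {a..b} u"
    unfolding continuous_on_eq_continuous_within using DERIV_continuous[OF w] by blast
  show "(u has_real_derivative u1 x) (at x)" if "x \<in> {a<..<b}"
    using w[of x] that at_within_interior[of x "{a..b}"] by auto
  show "(u1 has_real_derivative lam * u x - \<bar>u x\<bar> powr (p - 2) * u x) (at x)" if "x \<in> {a<..<b}"
    using assms that by (simp add: nls_on_def)
qed

text \<open>
  The equation is autonomous, of second order and odd in \<open>u\<close>; hence translations, the reflection and
  the change of sign all preserve it.
\<close>

lemma nls_on_symmetry:
  assumes sol: "nls_on p lam a b u u1"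
    and \<sigma>: "\<sigma> = 1 \<or> \<sigma> = -1" and \<epsilon>: "\<epsilon> = 1 \<or> \<epsilon> = -1"
    and sub: "\<And>t. t \<in> {a'..b'} \<Longrightarrow> c + \<sigma> * t \<in> {a..b}"
  shows "nls_on p lam a' b' (\<lambda>t. \<epsilon> * u (c + \<sigma> * t)) (\<lambda>t. \<epsilon> * \<sigma> * u1 (c + \<sigma> * t))"
proof -
  have im: "(\<lambda>t. c + \<sigma> * t) ` {a'..b'} \<subseteq> {a..b}" using sub by auto
  have 1: "((\<lambda>t. \<epsilon> * u (c + \<sigma> * t)) has_real_derivative \<epsilon> * \<sigma> * u1 (c + \<sigma> * t)) (at t within {a'..b'})"
    if t: "t \<in> {a'..b'}" for t
  proof -
    have "(u has_real_derivative u1 (c + \<sigma> * t)) (at (c + \<sigma> * t) within {a..b})"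
      using nls_on_deriv_within[OF sol] sub t by blast
    then have "(u has_real_derivative u1 (c + \<sigma> * t))
        (at (c + \<sigma> * t) within (\<lambda>t. c + \<sigma> * t) ` {a'..b'})"
      using im by (rule DERIV_subset)
    moreover have "((\<lambda>t. c + \<sigma> * t) has_real_derivative \<sigma>) (at t within {a'..b'})"
      by (auto intro!: derivative_eq_intros)
    ultimately have "(u \<circ> (\<lambda>t. c + \<sigma> * t) has_real_derivative u1 (c + \<sigma> * t) * \<sigma>)
        (at t within {a'..b'})"
      by (rule DERIV_image_chain)
    from DERIV_cmult[OF this, of \<epsilon>] show ?thesis by (simp add: o_def mult_ac)
  qed
  have 2: "continuous_on {a'..b'} (\<lambda>t. \<epsilon> * \<sigma> * u1 (c + \<sigma> * t))"
    by (intro continuous_intros continuous_on_compose2[OF nls_on_cont_deriv[OF sol]]) (use im in auto)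
  have 3: "((\<lambda>t. \<epsilon> * \<sigma> * u1 (c + \<sigma> * t)) has_real_derivative
      lam * (\<epsilon> * u (c + \<sigma> * t)) - \<bar>\<epsilon> * u (c + \<sigma> * t)\<bar> powr (p - 2) * (\<epsilon> * u (c + \<sigma> * t))) (at t)"
    if t: "t \<in> {a'<..<b'}" for t
  proof -
    have "c + \<sigma> * a' \<in> {a..b}" "c + \<sigma> * b' \<in> {a..b}" using sub[of a'] sub[of b'] t by auto
    then have "c + \<sigma> * t \<in> {a<..<b}" using \<sigma> t by auto
    then have "(u1 has_real_derivative lam * u (c + \<sigma> * t) -
        \<bar>u (c + \<sigma> * t)\<bar> powr (p - 2) * u (c + \<sigma> * t)) (at (c + \<sigma> * t))"
      using nls_on_deriv2[OF sol] by blast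
    moreover have "((\<lambda>t. c + \<sigma> * t) has_real_derivative \<sigma>) (at t)"
      by (auto intro!: derivative_eq_intros)
    ultimately have "((\<lambda>t. u1 (c + \<sigma> * t)) has_real_derivative
        (lam * u (c + \<sigma> * t) - \<bar>u (c + \<sigma> * t)\<bar> powr (p - 2) * u (c + \<sigma> * t)) * \<sigma>) (at t)"
      by (rule DERIV_chain2)
    from DERIV_cmult[OF this, of "\<epsilon> * \<sigma>"] show ?thesis
      using \<sigma> \<epsilon> by (auto simp: algebra_simps)
  qed
  show ?thesis unfolding nls_on_def using 1 2 3 by blast
qed

text \<open>
  Gronwall: if \<open>L\<close> is a Lipschitz constant of the nonlinearity on the range of both solutions, the squared
  distance \<open>D\<close> of the phase points satisfies \<open>D' \<le> (1 + L) D\<close>, so \<open>D exp (-(1 + L) s)\<close> decreases from \<open>0\<close>.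
\<close>

lemma nls_unique:
  assumes p: "p > 2" and u: "nls_on p lam 0 T u u1" and v: "nls_on p lam 0 T v v1"
    and init: "u 0 = v 0" "u1 0 = v1 0" and t: "t \<in> {0..T}"
  shows "u t = v t \<and> u1 t = v1 t"
proof -
  note cu = nls_on_cont[OF u] nls_on_cont_deriv[OF u]
  note cv = nls_on_cont[OF v] nls_on_cont_deriv[OF v]
  obtain K1 where K1: "\<And>x. x \<in> {0..T} \<Longrightarrow> \<bar>u x\<bar> \<le> K1"
    using compact_imp_bounded[OF compact_continuous_image[OF cu(1) compact_Icc]] unfolding bounded_iff
    by (metis imageI real_norm_def)
  obtain K2 where K2: "\<And>x. x \<in> {0..T} \<Longrightarrow> \<bar>v x\<bar> \<le> K2"
    using compact_imp_bounded[OF compact_continuous_image[OF cv(1) compact_Icc]] unfolding bounded_iff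
    by (metis imageI real_norm_def)
  define f where "f s = lam * s - \<bar>s\<bar> powr (p - 2) * s" for s
  obtain L where L: "L \<ge> 0"
    "\<And>x y. \<bar>x\<bar> \<le> max K1 K2 \<Longrightarrow> \<bar>y\<bar> \<le> max K1 K2 \<Longrightarrow> \<bar>f x - f y\<bar> \<le> L * \<bar>x - y\<bar>"
    using nonlinearity_lipschitz[OF p] unfolding f_def by metis
  define D where "D s = (u s - v s)\<^sup>2 + (u1 s - v1 s)\<^sup>2" for s
  define g where "g s = D s * exp (- (1 + L) * s)" for s
  have "g t \<le> g 0"
  proof (rule DERIV_nonpos_imp_decreasing_open[of 0 t])
    show "0 \<le> t" using t by simp
    fix s assume s: "0 < s" "s < t"
    then have s': "s \<in> {0<..<T}" "s \<in> {0..T}" using t by auto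
    have dD: "(D has_real_derivative 2 * (u s - v s) * (u1 s - v1 s)
        + 2 * (u1 s - v1 s) * (f (u s) - f (v s))) (at s)"
      unfolding D_def f_def
      by (auto intro!: derivative_eq_intros nls_on_deriv[OF u s'(1)] nls_on_deriv[OF v s'(1)]
          nls_on_deriv2[OF u s'(1)] nls_on_deriv2[OF v s'(1)] simp: algebra_simps)
    have "\<bar>f (u s) - f (v s)\<bar> \<le> L * \<bar>u s - v s\<bar>"
      using K1[OF s'(2)] K2[OF s'(2)] by (intro L(2)) auto
    then have "\<bar>u1 s - v1 s\<bar> * \<bar>f (u s) - f (v s)\<bar> \<le> \<bar>u1 s - v1 s\<bar> * (L * \<bar>u s - v s\<bar>)"
      by (rule mult_left_mono) simp
    then have "2 * (u1 s - v1 s) * (f (u s) - f (v s)) \<le> 2 * \<bar>u1 s - v1 s\<bar> * (L * \<bar>u s - v s\<bar>)"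
      using abs_ge_self[of "(u1 s - v1 s) * (f (u s) - f (v s))"] unfolding abs_mult by linarith
    also have "\<dots> = L * (2 * \<bar>u s - v s\<bar> * \<bar>u1 s - v1 s\<bar>)" by simp
    also have "\<dots> \<le> L * D s"
      using sum_squares_bound[of "\<bar>u s - v s\<bar>" "\<bar>u1 s - v1 s\<bar>"] L(1)
      unfolding D_def by (intro mult_left_mono) auto
    finally have "2 * (u s - v s) * (u1 s - v1 s) + 2 * (u1 s - v1 s) * (f (u s) - f (v s)) \<le> D s + L * D s"
      using sum_squares_bound[of "u s - v s" "u1 s - v1 s"] unfolding D_def by linarith
    then have le: "2 * (u s - v s) * (u1 s - v1 s) + 2 * (u1 s - v1 s) * (f (u s) - f (v s)) - (1 + L) * D s \<le> 0"
      by (simp add: algebra_simps)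
    have "(g has_real_derivative (2 * (u s - v s) * (u1 s - v1 s)
        + 2 * (u1 s - v1 s) * (f (u s) - f (v s)) - (1 + L) * D s) * exp (- (1 + L) * s)) (at s)"
      unfolding g_def by (auto intro!: derivative_eq_intros dD simp: algebra_simps)
    moreover have "(2 * (u s - v s) * (u1 s - v1 s)
        + 2 * (u1 s - v1 s) * (f (u s) - f (v s)) - (1 + L) * D s) * exp (- (1 + L) * s) \<le> 0"
      using le by (simp add: mult_nonpos_nonneg)
    ultimately show "\<exists>y. (g has_real_derivative y) (at s) \<and> y \<le> 0" by blast
  next
    have "continuous_on {0..T} g" unfolding g_def D_def
      by (intro continuous_intros cu cv)
    then show "continuous_on {0..t} g" using t by (auto elim: continuous_on_subset)
  qed
  moreover have "g 0 = 0" using init by (simp add: g_def D_def)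
  ultimately have "D t \<le> 0" unfolding g_def
    by (metis exp_gt_zero mult_le_0_iff not_le)
  then have "(u t - v t)\<^sup>2 = 0 \<and> (u1 t - v1 t)\<^sup>2 = 0"
    unfolding D_def by (metis add_nonneg_eq_0_iff antisym add_nonneg_nonneg zero_le_power2)
  then show ?thesis by simp
qed

text \<open>
  Uniqueness applied to two pieces of one solution: the piece that leaves \<open>c\<close> in direction \<open>\<sigma>\<close> and the
  piece that leaves \<open>d\<close> in direction \<open>\<tau>\<close>. All symmetries of nodal solutions are instances.
\<close>

lemma nls_propagate:
  assumes p: "p > 2" and sol: "nls_on p lam a b u u1"
    and \<sigma>: "\<sigma> = 1 \<or> \<sigma> = -1" and \<tau>: "\<tau> = 1 \<or> \<tau> = -1" and \<epsilon>: "\<epsilon> = 1 \<or> \<epsilon> = -1"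
    and init: "u c = \<epsilon> * u d" "\<sigma> * u1 c = \<epsilon> * \<tau> * u1 d"
    and t: "t \<ge> 0" and cd: "c \<in> {a..b}" "d \<in> {a..b}" "c + \<sigma> * t \<in> {a..b}" "d + \<tau> * t \<in> {a..b}"
  shows "u (c + \<sigma> * t) = \<epsilon> * u (d + \<tau> * t) \<and> \<sigma> * u1 (c + \<sigma> * t) = \<epsilon> * \<tau> * u1 (d + \<tau> * t)"
proof -
  have A: "nls_on p lam 0 t (\<lambda>t. 1 * u (c + \<sigma> * t)) (\<lambda>t. 1 * \<sigma> * u1 (c + \<sigma> * t))"
    by (rule nls_on_symmetry[OF sol \<sigma>]) (use \<sigma> cd in auto)
  have B: "nls_on p lam 0 t (\<lambda>t. \<epsilon> * u (d + \<tau> * t)) (\<lambda>t. \<epsilon> * \<tau> * u1 (d + \<tau> * t))"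
    by (rule nls_on_symmetry[OF sol \<tau> \<epsilon>]) (use \<tau> cd in auto)
  show ?thesis
    using nls_unique[OF p A B, of t] init t by simp
qed

lemma nls_hamiltonian:
  assumes p: "p > 2" and sol: "nls_on p lam a b u u1" and "a < b" "x \<in> {a..b}" "y \<in> {a..b}"
  shows "(u1 x)\<^sup>2 / 2 + \<bar>u x\<bar> powr p / p - lam / 2 * (u x)\<^sup>2 =
         (u1 y)\<^sup>2 / 2 + \<bar>u y\<bar> powr p / p - lam / 2 * (u y)\<^sup>2"
proof -
  define H where "H x = (u1 x)\<^sup>2 / 2 + \<bar>u x\<bar> powr p / p - lam / 2 * (u x)\<^sup>2" for x
  have "H x = H a" if "x \<in> {a..b}" for x
  proof (rule DERIV_isconst2[OF \<open>a < b\<close>])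
    show "continuous_on {a..b} H" unfolding H_def
      using p by (intro continuous_intros continuous_on_abs_powr nls_on_cont[OF sol] nls_on_cont_deriv[OF sol]) auto
    fix x assume x: "a < x" "x < b"
    have "((\<lambda>x. \<bar>u x\<bar> powr p) has_real_derivative p * (\<bar>u x\<bar> powr (p - 2) * u x) * u1 x) (at x)"
      using p x by (intro DERIV_chain2[OF powr_abs_deriv] nls_on_deriv[OF sol]) auto
    then have d: "((\<lambda>x. \<bar>u x\<bar> powr p / p) has_real_derivative \<bar>u x\<bar> powr (p - 2) * u x * u1 x) (at x)"
      using DERIV_cdivide[of "\<lambda>x. \<bar>u x\<bar> powr p" "p * (\<bar>u x\<bar> powr (p - 2) * u x) * u1 x" x UNIV p] p
      by (simp add: mult.assoc)
    have x': "x \<in> {a<..<b}" using x by simp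
    have e1: "((\<lambda>x. (u1 x)\<^sup>2 / 2) has_real_derivative
        u1 x * (lam * u x - \<bar>u x\<bar> powr (p - 2) * u x)) (at x)"
      by (auto intro!: derivative_eq_intros nls_on_deriv2[OF sol x'])
    have e3: "((\<lambda>x. lam / 2 * (u x)\<^sup>2) has_real_derivative lam * u x * u1 x) (at x)"
      by (auto intro!: derivative_eq_intros nls_on_deriv[OF sol x'])
    show "(H has_real_derivative 0) (at x)"
      using DERIV_diff[OF DERIV_add[OF e1 d] e3] unfolding H_def by (simp add: algebra_simps)
  qed (use that in auto)
  from this[of x] this[of y] assms show ?thesis unfolding H_def by metis
qed

section \<open>The shape of nodal solutions\<close>

text \<open>
  The potential is \<open>s^2\<close> times the increasing function \<open>s^(p-2)/p - lam/2\<close>. Where it is positive both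
  factors are positive and increasing, so no positive value is taken twice on the half-line.
\<close>

lemma potential_injective:
  fixes p lam a b :: real
  assumes p: "p > 2" and ab: "a > 0" "b > 0"
    and eq: "a powr p / p - lam / 2 * a\<^sup>2 = b powr p / p - lam / 2 * b\<^sup>2"
    and pos: "b powr p / p - lam / 2 * b\<^sup>2 > 0"
  shows "a = b"
proof -
  define B where "B s = s powr (p - 2) / p - lam / 2" for s
  have fac: "s powr p / p - lam / 2 * s\<^sup>2 = s\<^sup>2 * B s" if "s > 0" for s
    using that powr_add[of s "p - 2" 2] by (simp add: B_def algebra_simps powr_numeral)
  have *: False if "x < y" "x > 0" "x\<^sup>2 * B x = y\<^sup>2 * B y" "x\<^sup>2 * B x > 0" for x y
  proof -
    have "B x > 0" using that(2,4) by (metis zero_less_mult_pos zero_less_power)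
    have "B x < B y" unfolding B_def using that p
      by (intro diff_strict_right_mono divide_strict_right_mono powr_less_mono2) auto
    moreover have "x\<^sup>2 < y\<^sup>2" using that by (intro power_strict_mono) auto
    ultimately have "x\<^sup>2 * B x < y\<^sup>2 * B y"
      using \<open>B x > 0\<close> that by (intro mult_strict_mono) auto
    then show False using that by simp
  qed
  show ?thesis
    using *[of a b] *[of b a] eq pos fac[of a] fac[of b] ab by (metis linorder_neqE_linordered_idom)
qed

text \<open>
  Let \<open>z\<close> be the first zero. Then \<open>u'(z) \<noteq> 0\<close>, as otherwise \<open>u\<close> would vanish identically, and the
  Hamiltonian \<open>h = u'(z)^2 / 2\<close> is positive. A critical point \<open>c\<close> in \<open>(0, z)\<close> would have \<open>u(c) = u(0)\<close> by
  \<open>potential_injective\<close>, so \<open>u\<close> would repeat itself from \<open>c\<close> on and \<open>z - c\<close> would be an earlier zero. By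
  oddness about \<open>z\<close> \<open>0\<close> is thus the only critical point in \<open>[0, 2 z)\<close>, and since \<open>u(2 z + t) = - u(t)\<close>
  the critical point \<open>1\<close> must be a multiple of \<open>2 z\<close>.
\<close>

lemma nodal_structure:
  assumes p: "p > 2" and sol: "nls_on p lam 0 1 u u1"
    and bc: "u1 0 = 0" "u1 1 = 0" and u0: "u 0 > 0" and neg: "y \<in> {0..1}" "u y < 0"
  obtains z h :: real and k :: nat
  where "k \<ge> 1" "z > 0" "2 * real k * z = 1" "h > 0" "u z = 0"
    "\<forall>x\<in>{0..<z}. u x > 0"
    "\<forall>x\<in>{0..1}. (u1 x)\<^sup>2 / 2 + \<bar>u x\<bar> powr p / p - lam / 2 * (u x)\<^sup>2 = h"
    "\<forall>t\<in>{0..z}. u (z + t) = - u (z - t) \<and> u1 (z + t) = u1 (z - t)"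
    "\<forall>t\<in>{0..1 - 2 * z}. u (2 * z + t) = - u t \<and> u1 (2 * z + t) = - u1 t"
proof -
  note cu = nls_on_cont[OF sol]
  define Z where "Z = {x \<in> {0..1}. u x = 0}"
  have sign_zero: "\<exists>s\<in>Z. s \<le> x" if "x \<in> {0..1}" "u x \<le> 0" for x
  proof -
    have "\<exists>s. 0 \<le> s \<and> s \<le> x \<and> u s = 0"
      using IVT2'[of u x 0 0] that u0 continuous_on_subset[OF cu, of "{0..x}"] by auto
    then show ?thesis using that by (auto simp: Z_def)
  qed
  have "compact Z"
  proof -
    have "closed Z" unfolding Z_def
      using continuous_closed_preimage_constant[OF cu closed_atLeastAtMost] by simp
    moreover have "Z \<subseteq> {0..1}" by (auto simp: Z_def)
    ultimately show ?thesis using compact_Int_closed[of "{0..1}" Z] by (simp add: Int_absorb1)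
  qed
  moreover have "Z \<noteq> {}" using sign_zero[of y] neg by auto
  ultimately obtain z where z: "z \<in> Z" "\<And>s. s \<in> Z \<Longrightarrow> z \<le> s"
    using compact_attains_inf by metis
  have zu: "u z = 0" and z01: "z \<in> {0..1}" using z by (auto simp: Z_def)
  have pos: "u x > 0" if "x \<in> {0..<z}" for x
  proof (rule ccontr)
    assume "\<not> ?thesis"
    then show False using sign_zero[of x] that z(2) z01 by force
  qed
  have z0: "z > 0" using zu u0 z01 by (cases "z = 0") auto
  have z1: "z < 1" using pos[of y] neg zu z01 by (cases "y = z"; cases "z = 1") auto
  have u1z: "u1 z \<noteq> 0"
  proof
    assume "u1 z = 0"
    then have "u (z + (-1) * z) = (-1) * u (z + (-1) * z)"
      using nls_propagate[OF p sol, of "-1" "-1" "-1" z z z] zu z01 by simp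
    then show False using u0 by simp
  qed
  define h where "h = (u1 z)\<^sup>2 / 2"
  have h0: "h > 0" using u1z by (simp add: h_def)
  have ham: "(u1 x)\<^sup>2 / 2 + \<bar>u x\<bar> powr p / p - lam / 2 * (u x)\<^sup>2 = h" if "x \<in> {0..1}" for x
    using nls_hamiltonian[OF p sol _ that z01] zu by (simp add: h_def)
  have crit: "u1 c \<noteq> 0" if c: "c \<in> {0<..<z}" for c
  proof
    assume c1: "u1 c = 0"
    have c01: "c \<in> {0..1}" using c z01 by auto
    have uc: "u c > 0" using pos c by auto
    have "u c = u 0"
    proof (rule potential_injective[OF p uc u0])
      have "u c powr p / p - lam / 2 * (u c)\<^sup>2 = h" using ham[OF c01] c1 uc by simp
      moreover have "u 0 powr p / p - lam / 2 * (u 0)\<^sup>2 = h" using ham[of 0] bc u0 by simp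
      ultimately show "u c powr p / p - lam / 2 * (u c)\<^sup>2 = u 0 powr p / p - lam / 2 * (u 0)\<^sup>2"
        "u 0 powr p / p - lam / 2 * (u 0)\<^sup>2 > 0" using h0 by simp_all
    qed
    then have "u (c + 1 * (z - c)) = 1 * u (0 + 1 * (z - c))"
      using nls_propagate[OF p sol, of 1 1 1 c 0 "z - c"] c z01 c1 bc by auto
    then show False using zu pos[of "z - c"] c by auto
  qed
  have odd_z: "u (z + t) = - u (z - t) \<and> u1 (z + t) = u1 (z - t)"
    if "t \<ge> 0" "z + t \<le> 1" "t \<le> z" for t
    using nls_propagate[OF p sol, of 1 "-1" "-1" z z t] that zu z01 by auto
  \<comment> \<open>otherwise oddness about \<open>z\<close> maps the critical point \<open>1\<close> into \<open>(0, z)\<close>\<close>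
  have z2: "2 * z \<le> 1"
  proof (rule ccontr)
    assume "\<not> ?thesis"
    then have "u1 1 = u1 (2 * z - 1)" using odd_z[of "1 - z"] z1 by auto
    then show False using crit[of "2 * z - 1"] bc \<open>\<not> 2 * z \<le> 1\<close> z1 by auto
  qed
  have at2z: "u (2 * z) = - u 0" "u1 (2 * z) = 0"
    using odd_z[of z] z0 z2 bc by auto
  have shift: "u (2 * z + t) = - u t \<and> u1 (2 * z + t) = - u1 t" if "t \<in> {0..1 - 2 * z}" for t
    using nls_propagate[OF p sol, of 1 1 "-1" "2 * z" 0 t] that at2z bc z0 z2 by auto
  have iter: "u1 (2 * real n * z + t) = 0 \<longleftrightarrow> u1 t = 0" if "t \<ge> 0" "2 * real n * z + t \<le> 1" for n t
    using that
  proof (induction n)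
    case 0
    then show ?case by simp
  next
    case (Suc n)
    have eq: "2 * real (Suc n) * z + t = 2 * z + (2 * real n * z + t)" by (simp add: algebra_simps)
    have "2 * real n * z \<ge> 0" using z0 by simp
    then have r: "2 * real n * z + t \<in> {0..1 - 2 * z}" using Suc.prems eq by auto
    have "u1 (2 * real n * z + t) = 0 \<longleftrightarrow> u1 t = 0"
      using Suc.IH Suc.prems(1) r z0 by auto
    then show ?case unfolding eq using shift[OF r] by simp
  qed
  define k where "k = nat \<lfloor>1 / (2 * z)\<rfloor>"
  have "1 / (2 * z) \<ge> 1" using z0 z2 by simp
  then have kk: "real k \<le> 1 / (2 * z)" "1 / (2 * z) < real k + 1" "k \<ge> 1"
    unfolding k_def by linarith+
  define t where "t = 1 - 2 * real k * z"
  have t: "0 \<le> t" "t < 2 * z"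
    using kk z0 by (auto simp: t_def field_simps)
  have "u1 t = 0" using iter[of t k] t bc by (simp add: t_def)
  moreover have "u1 t \<noteq> 0" if tn: "t \<noteq> 0"
  proof -
    consider "t \<in> {0<..<z}" | "t = z" | "t \<in> {z<..<2*z}" using tn t by (cases rule: linorder_cases[of t z]) auto
    then show ?thesis
    proof cases
      case 3
      then have "u1 t = u1 (2 * z - t)" using odd_z[of "t - z"] z2 by auto
      then show ?thesis using crit[of "2 * z - t"] 3 by auto
    qed (use crit u1z in auto)
  qed
  ultimately have k1: "2 * real k * z = 1" by (auto simp: t_def)
  show ?thesis
  proof (rule that[OF kk(3) z0 k1 h0 zu])
    show "\<forall>t\<in>{0..z}. u (z + t) = - u (z - t) \<and> u1 (z + t) = u1 (z - t)"
      using odd_z z2 by simp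
  qed (use pos ham shift in blast)+
qed

text \<open>
  Stated for the even densities \<open>u^2\<close>, \<open>u'^2\<close> and \<open>|u|^p\<close>, which do not see the signs in
  \<open>nodal_structure\<close>.
\<close>

lemma integral_periodic_pieces:
  fixes G :: "real \<Rightarrow> real"
  assumes cont: "continuous_on {0..1} G" and z: "z > 0" and k: "2 * real k * z = 1"
    and refl: "\<And>t. t \<in> {0..z} \<Longrightarrow> G (z + t) = G (z - t)"
    and shift: "\<And>t. t \<in> {0..1 - 2 * z} \<Longrightarrow> G (2 * z + t) = G t"
  shows "integral {0..1} G = 2 * real k * integral {0..z} G"
proof -
  have int: "G integrable_on {a..b}" if "0 \<le> a" "b \<le> 1" for a b
    using continuous_on_subset[OF cont] that by (intro integrable_continuous_real) auto
  have k1: "k \<ge> 1" using k by (cases k) auto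
  have z2: "2 * z \<le> 1" using k k1 z mult_right_mono[of 1 "real k" "2 * z"] by (simp add: mult_ac)
  have "integral {z..2*z} G = integral {0..z} (\<lambda>t. G (z + t))"
    using integral_shift_real_ivl[of z z "2*z" G] by (simp add: add.commute)
  also have "\<dots> = integral {0..z} (\<lambda>t. G (z - t))"
    by (rule integral_cong) (use refl in auto)
  also have "\<dots> = integral {-z..0} (\<lambda>t. G (z + t))"
    using Henstock_Kurzweil_Integration.integral_reflect_real[of z 0 "\<lambda>t. G (z - t)"] by simp
  also have "\<dots> = integral {0..z} G"
    using integral_shift_real_ivl[of 0 z z G] by (simp add: add.commute)
  finally have two: "integral {0..2*z} G = 2 * integral {0..z} G"
    using Henstock_Kurzweil_Integration.integral_combine[of 0 z "2*z" G] int[of 0 "2*z"] z z2 by simp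
  have "integral {0..2 * real n * z} G = real n * integral {0..2*z} G" if "n \<le> k" for n
    using that
  proof (induction n)
    case 0
    then show ?case by simp
  next
    case (Suc n)
    have "real (Suc n) * (2 * z) \<le> real k * (2 * z)" using Suc.prems z by (intro mult_right_mono) auto
    then have le: "2 * z + 2 * real n * z \<le> 1" using k by (simp add: algebra_simps)
    have nn: "0 \<le> 2 * real n * z" using z by simp
    have e: "2 * real (Suc n) * z = 2 * real n * z + 2 * z" by (simp add: algebra_simps)
    have "integral {2*z..2 * real (Suc n) * z} G = integral {0..2 * real n * z} (\<lambda>t. G (2*z + t))"
      using integral_shift_real_ivl[of "2*z" "2*z" "2 * real (Suc n) * z" G] unfolding e
      by (simp add: add.commute)
    also have "\<dots> = integral {0..2 * real n * z} G"
      by (rule integral_cong) (use shift le in auto)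
    finally show ?case
      using Henstock_Kurzweil_Integration.integral_combine[of 0 "2*z" "2 * real (Suc n) * z" G]
        int[of 0 "2 * real (Suc n) * z"] z le nn e Suc by (simp add: algebra_simps)
  qed
  from this[of k] show ?thesis using two k by (simp add: algebra_simps)
qed


section \<open>Hidden convexity in the mass variable\<close>

text \<open>
  The tangent to the concave function \<open>\<omega>^((p-2)/4)\<close> at \<open>\<omega> = 1\<close>, evaluated at \<open>\<omega> = r^4\<close>. Concavity is
  obtained from Young's inequality with the weights \<open>(p-2)/4\<close> and \<open>(6-p)/4\<close>.
\<close>

lemma powr_tangent_bound:
  fixes p r :: real
  assumes "2 < p" "p < 6" "r > 0"
  shows "r powr (p - 2) \<le> 1 + (p - 2) / 4 * (r ^ 4 - 1)"
proof -
  have "(r ^ 4) powr ((p - 2) / 4) * 1 powr ((6 - p) / 4) \<le> (p - 2) / 4 * r ^ 4 + (6 - p) / 4 * 1"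
    using assms by (intro Youngs_inequality_0) (auto simp: field_simps)
  moreover have "(r ^ 4) powr ((p - 2) / 4) = r powr (p - 2)"
  proof -
    have "(r powr 4) powr ((p - 2) / 4) = r powr (4 * ((p - 2) / 4))" by (rule powr_powr)
    moreover have "4 * ((p - 2) / 4) = p - 2" by (simp add: field_simps)
    moreover have "r powr 4 = r ^ 4" using assms by (simp add: powr_numeral)
    ultimately show ?thesis by metis
  qed
  ultimately show ?thesis by (simp add: field_simps)
qed

text \<open>
  The tangent to the strictly convex function \<open>\<omega>^(-1/2)\<close> at \<open>\<omega> = 1\<close>, evaluated at \<open>\<omega> = r^4\<close>.
\<close>

lemma pressure_tangent_bound:
  fixes r :: real
  assumes "r > 0"
  shows "1 / r\<^sup>2 + r ^ 4 / 2 - 3 / 2 \<ge> 0"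
    and "1 / r\<^sup>2 + r ^ 4 / 2 - 3 / 2 = 0 \<Longrightarrow> r = 1"
proof -
  have eq: "1 / r\<^sup>2 + r ^ 4 / 2 - 3 / 2 = (r\<^sup>2 - 1)\<^sup>2 * (r\<^sup>2 + 2) / (2 * r\<^sup>2)"
    using assms by (simp add: field_simps power2_eq_square power4_eq_xxxx)
  show "1 / r\<^sup>2 + r ^ 4 / 2 - 3 / 2 \<ge> 0" unfolding eq by simp
  assume "1 / r\<^sup>2 + r ^ 4 / 2 - 3 / 2 = 0"
  then have "(r\<^sup>2 - 1)\<^sup>2 * (r\<^sup>2 + 2) = 0" unfolding eq using assms by simp
  moreover have "r\<^sup>2 + 2 \<noteq> 0" using zero_le_power2[of r] by linarith
  ultimately have "r\<^sup>2 = 1" by simp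
  then show "r = 1" using assms by (simp add: power2_eq_1_iff)
qed

text \<open>
  The pointwise form of the convexity argument. Here \<open>a\<close> and \<open>b\<close> are the value and slope of the solution,
  \<open>r a\<close> and \<open>q\<close> those of the competitor at the point of equal accumulated mass, \<open>X = a^(p-2)\<close> and
  \<open>Y = (r a)^(p-2)\<close>; the hypothesis on \<open>b\<close> is the Hamiltonian identity. The left side is the derivative
  of the function \<open>A\<close> in the next lemma. The right side is a square, which expresses the convexity of
  \<open>w_s^2 / w\<close>, plus the two gaps to the tangents above.
\<close>

lemma convexity_identity:
  fixes p h lam a b q r X Y :: real
  assumes "p > 0" "r > 0" and b: "b\<^sup>2 = 2 * h - 2 * (a\<^sup>2 * X) / p + lam * a\<^sup>2"
  shows "(q\<^sup>2 / 2 + h) / r\<^sup>2 - a\<^sup>2 * Y / p - (b\<^sup>2 / 2 - a\<^sup>2 * X / p + h)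
      - (q * r * b + r ^ 4 * a\<^sup>2 * (lam - X) / 4 - 3 * r ^ 4 * b\<^sup>2 / 4) + (b\<^sup>2 + a\<^sup>2 * (lam - X)) / 4
    = (q / r - r\<^sup>2 * b)\<^sup>2 / 2 + h * (1 / r\<^sup>2 + r ^ 4 / 2 - 3 / 2)
      + a\<^sup>2 / p * (X * (1 + (p - 2) / 4 * (r ^ 4 - 1)) - Y)"
proof -
  define i P where "i = 1 / r\<^sup>2" and "P = 1 / p"
  have P: "p * P = 1" using \<open>p > 0\<close> by (simp add: P_def)
  have sq: "(q / r - r\<^sup>2 * b)\<^sup>2 = q\<^sup>2 * i - 2 * q * r * b + r ^ 4 * b\<^sup>2"
    using assms by (simp add: i_def power2_eq_square power4_eq_xxxx field_simps)
  have "(q\<^sup>2 / 2 + h) * i - a\<^sup>2 * Y * P - (b\<^sup>2 / 2 - a\<^sup>2 * X * P + h)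
      - (q * r * b + r ^ 4 * a\<^sup>2 * (lam - X) / 4 - 3 * r ^ 4 * b\<^sup>2 / 4) + (b\<^sup>2 + a\<^sup>2 * (lam - X)) / 4
    - ((q / r - r\<^sup>2 * b)\<^sup>2 / 2 + h * (i + r ^ 4 / 2 - 3 / 2)
      + a\<^sup>2 * P * (X * (1 + (p - 2) / 4 * (r ^ 4 - 1)) - Y))
    = (r ^ 4 - 1) / 4 * (b\<^sup>2 - (2 * h - 2 * (a\<^sup>2 * X) * P + lam * a\<^sup>2))
      + (1 - p * P) * (a\<^sup>2 * X * (r ^ 4 - 1) / 4)"
    unfolding sq by (simp add: field_simps)
  also have "\<dots> = 0" using b P by (simp add: P_def)
  finally show ?thesis by (simp add: i_def P_def)
qed

text \<open>
  Both profiles are compared at points of equal accumulated mass: \<open>T x\<close> is the point with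
  \<open>\<integral>_0^(T x) U^2 = \<integral>_0^x u^2\<close>, and \<open>g x = U (T x)\<close>. The function \<open>A x\<close> is the difference between
  energy plus \<open>h\<close> times length of \<open>U\<close> on \<open>[0, T x]\<close> and of \<open>u\<close> on \<open>[0, x]\<close>, corrected by the boundary
  terms that an integration by parts of the first variation leaves behind. By \<open>convexity_identity\<close> it is
  nondecreasing. It starts at \<open>0\<close> and tends to the difference of the energies, because the lengths
  cancel and the boundary terms vanish at both ends. Equality forces \<open>A' = 0\<close>, hence \<open>g = u\<close>, hence \<open>T\<close>
  is the identity.
\<close>

lemma quarter_wave_comparison:
  fixes p lam l h :: real
  assumes p: "2 < p" "p < 6" and l: "l > 0"
    and u: "nls_on p lam 0 l u u1" and u10: "u1 0 = 0"
    and upos: "\<And>x. x \<in> {0..<l} \<Longrightarrow> u x > 0" and ul: "u l = 0" and h: "h > 0"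
    and ham: "\<And>x. x \<in> {0..l} \<Longrightarrow> (u1 x)\<^sup>2 / 2 + \<bar>u x\<bar> powr p / p - lam / 2 * (u x)\<^sup>2 = h"
    and U: "\<And>x. x \<in> {0..l} \<Longrightarrow> (U has_real_derivative U1 x) (at x within {0..l})"
    and cU1: "continuous_on {0..l} U1"
    and Upos: "\<And>x. x \<in> {0..<l} \<Longrightarrow> U x > 0" and Ul: "U l = 0"
    and mass: "integral {0..l} (\<lambda>x. (U x)\<^sup>2) = integral {0..l} (\<lambda>x. (u x)\<^sup>2)"
  defines "eU \<equiv> \<lambda>x. (U1 x)\<^sup>2 / 2 - \<bar>U x\<bar> powr p / p"
    and "eu \<equiv> \<lambda>x. (u1 x)\<^sup>2 / 2 - \<bar>u x\<bar> powr p / p"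
  shows "integral {0..l} eu \<le> integral {0..l} eU"
    and "integral {0..l} eu = integral {0..l} eU \<Longrightarrow> x \<in> {0..l} \<Longrightarrow> U x = u x"
proof -
  have cu: "continuous_on {0..l} u" and cu1: "continuous_on {0..l} u1"
    using nls_on_cont[OF u] nls_on_cont_deriv[OF u] .
  have cU: "continuous_on {0..l} U"
    unfolding continuous_on_eq_continuous_within using DERIV_continuous[OF U] by blast
  have U': "(U has_real_derivative U1 x) (at x)" if "x \<in> {0<..<l}" for x
    using U[of x] that at_within_interior[of x "{0..l}"] by auto
  note u' = nls_on_deriv[OF u] and u'' = nls_on_deriv2[OF u]
  have primitive: "continuous_on {0..l} (\<lambda>y. integral {0..y} f)"
    "\<And>y. y \<in> {0<..<l} \<Longrightarrow> ((\<lambda>y. integral {0..y} f) has_real_derivative f y) (at y)"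
    if f: "continuous_on {0..l} f" for f :: "real \<Rightarrow> real"
  proof -
    have d: "((\<lambda>y. integral {0..y} f) has_real_derivative f y) (at y within {0..l})" if "y \<in> {0..l}" for y
      using integral_has_real_derivative[OF f that] .
    show "continuous_on {0..l} (\<lambda>y. integral {0..y} f)"
      unfolding continuous_on_eq_continuous_within using DERIV_continuous[OF d] by blast
    show "((\<lambda>y. integral {0..y} f) has_real_derivative f y) (at y)" if "y \<in> {0<..<l}" for y
      using d[of y] that at_within_interior[of y "{0..l}"] by auto
  qed
  have ceU: "continuous_on {0..l} eU" and ceu: "continuous_on {0..l} eu"
    unfolding eU_def eu_def using p
    by (auto intro!: continuous_intros continuous_on_abs_powr cU cU1 cu cu1)
  have cU2: "continuous_on {0..l} (\<lambda>x. (U x)\<^sup>2)" and cu2: "continuous_on {0..l} (\<lambda>x. (u x)\<^sup>2)"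
    by (intro continuous_intros cU cu)+
  define mU where "mU y = integral {0..y} (\<lambda>x. (U x)\<^sup>2)" for y
  define mu where "mu y = integral {0..y} (\<lambda>x. (u x)\<^sup>2)" for y
  define PU where "PU y = integral {0..y} eU" for y
  define Pu where "Pu y = integral {0..y} eu" for y
  note cmU = primitive(1)[OF cU2, folded mU_def] and dmU = primitive(2)[OF cU2, folded mU_def]
  note cmu = primitive(1)[OF cu2, folded mu_def] and dmu = primitive(2)[OF cu2, folded mu_def]
  note cPU = primitive(1)[OF ceU, folded PU_def] and dPU = primitive(2)[OF ceU, folded PU_def]
  note cPu = primitive(1)[OF ceu, folded Pu_def] and dPu = primitive(2)[OF ceu, folded Pu_def]
  have m0: "mU 0 = 0" "mu 0 = 0" "PU 0 = 0" "Pu 0 = 0" by (simp_all add: mU_def mu_def PU_def Pu_def)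
  have ml: "mU l = mu l" using mass by (simp add: mU_def mu_def)
  have posU: "(U y)\<^sup>2 > 0" and posu: "(u y)\<^sup>2 > 0" if "y \<in> {0<..<l}" for y
    using Upos[of y] upos[of y] that by auto
  obtain S where S: "continuous_on {mU 0..mU l} S"
    "\<forall>x\<in>{0..l}. mU x \<in> {mU 0..mU l} \<and> S (mU x) = x"
    "\<forall>y\<in>{mU 0..mU l}. S y \<in> {0..l} \<and> mU (S y) = y"
    "\<forall>y\<in>{mU 0<..<mU l}. S y \<in> {0<..<l} \<and> (S has_real_derivative inverse ((U (S y))\<^sup>2)) (at y)"
    using increasing_inverse[OF l cmU dmU posU] by blast
  obtain s where s: "\<forall>x\<in>{0..l}. mu x \<in> {mu 0..mu l} \<and> s (mu x) = x"
    using increasing_inverse[OF l cmu dmu posu] by blast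
  have mu_in: "mu x \<in> {mU 0..mU l}" if "x \<in> {0..l}" for x
    using s that m0 ml by simp
  have mu_in': "mu x \<in> {mU 0<..<mU l}" if "x \<in> {0<..<l}" for x
  proof -
    have "s (mu 0) = 0" "s (mu l) = l" "s (mu x) = x" using s l that by auto
    then have "mu x \<noteq> mu 0" "mu x \<noteq> mu l" using that by auto
    then show ?thesis using mu_in[of x] that m0 ml by auto
  qed
  define T where "T x = S (mu x)" for x
  define g where "g x = U (T x)" for x
  have T_in: "T x \<in> {0..l}" and mUT: "mU (T x) = mu x" if "x \<in> {0..l}" for x
    using bspec[OF S(3) mu_in[OF that]] by (simp_all add: T_def)
  have T_in': "T x \<in> {0<..<l}" if "x \<in> {0<..<l}" for x
    using bspec[OF S(4) mu_in'[OF that]] by (simp add: T_def)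
  have T0: "T 0 = 0" and Tl: "T l = l"
    using bspec[OF S(2), of 0] bspec[OF S(2), of l] l m0 ml by (simp_all add: T_def)
  have cT: "continuous_on {0..l} T" unfolding T_def
    by (rule continuous_on_compose2[OF S(1) cmu]) (use mu_in in blast)
  have cg: "continuous_on {0..l} g" unfolding g_def
    by (rule continuous_on_compose2[OF cU cT]) (use T_in in blast)
  have gl: "g l = 0" by (simp add: g_def Tl Ul)
  have gpos: "g x > 0" if "x \<in> {0..<l}" for x
    using T_in'[of x] that T0 Upos[of "T x"] Upos[of 0] l by (cases "x = 0") (auto simp: g_def)
  have dT: "(T has_real_derivative (u x)\<^sup>2 / (g x)\<^sup>2) (at x)" if x: "x \<in> {0<..<l}" for x
    using DERIV_chain2[OF conjunct2[OF bspec[OF S(4) mu_in'[OF x]]] dmu[OF x]]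
    by (simp add: T_def[abs_def] g_def[abs_def] field_simps)
  have dg: "(g has_real_derivative U1 (T x) * ((u x)\<^sup>2 / (g x)\<^sup>2)) (at x)" if x: "x \<in> {0<..<l}" for x
    using DERIV_chain2[OF U'[OF T_in'[OF x]] dT[OF x]] by (simp add: g_def[abs_def])
  define A where "A x = PU (T x) + h * T x - Pu x - h * x - g x ^ 4 * u1 x / (4 * u x ^ 3) + u x * u1 x / 4" for x
  define D where "D x = (U1 (T x) / (g x / u x) - (g x / u x)\<^sup>2 * u1 x)\<^sup>2 / 2
      + h * (1 / (g x / u x)\<^sup>2 + (g x / u x) ^ 4 / 2 - 3 / 2)
      + (u x)\<^sup>2 / p * (u x powr (p - 2) * (1 + (p - 2) / 4 * ((g x / u x) ^ 4 - 1)) - g x powr (p - 2))" for x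
  have dA: "(A has_real_derivative D x) (at x)" if x: "x \<in> {0<..<l}" for x
  proof -
    define a b q r where "a = u x" and "b = u1 x" and "q = U1 (T x)" and "r = g x / u x"
    define X Y where "X = a powr (p - 2)" and "Y = g x powr (p - 2)"
    have a: "a > 0" using upos[of x] x by (simp add: a_def)
    have r: "r > 0" using gpos[of x] upos[of x] x by (simp add: r_def)
    have G: "g x = r * a" using a by (simp add: r_def a_def)
    have aX: "a powr p = a\<^sup>2 * X" using a powr_add[of a "p - 2" 2] by (simp add: X_def powr_numeral mult.commute)
    have gY: "g x powr p = (g x)\<^sup>2 * Y" using gpos[of x] x powr_add[of "g x" "p - 2" 2]
      by (simp add: Y_def powr_numeral mult.commute)
    have b2: "b\<^sup>2 = 2 * h - 2 * (a\<^sup>2 * X) / p + lam * a\<^sup>2"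
    proof -
      have "b\<^sup>2 / 2 + a\<^sup>2 * X / p - lam / 2 * a\<^sup>2 = h"
        using ham[of x] x a by (simp add: a_def[symmetric] b_def[symmetric] aX)
      moreover have "2 * (a\<^sup>2 * X) / p = 2 * (a\<^sup>2 * X / p)" "lam / 2 * a\<^sup>2 = lam * a\<^sup>2 / 2" by simp_all
      ultimately show ?thesis by linarith
    qed
    have du: "(u has_real_derivative b) (at x)" using u'[OF x] by (simp add: b_def)
    have du1: "(u1 has_real_derivative a * (lam - X)) (at x)"
      using u''[OF x] a by (simp add: a_def[symmetric] X_def algebra_simps)
    have dg': "(g has_real_derivative q / r\<^sup>2) (at x)"
      using dg[OF x] by (simp add: q_def r_def power_divide)
    have dT': "(T has_real_derivative 1 / r\<^sup>2) (at x)"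
      using dT[OF x] by (simp add: r_def power_divide)
    have d1: "((\<lambda>x. PU (T x)) has_real_derivative eU (T x) * (1 / r\<^sup>2)) (at x)"
      by (rule DERIV_chain2[OF dPU[OF T_in'[OF x]] dT'])
    have d2: "((\<lambda>x. g x ^ 4 * u1 x / (4 * u x ^ 3)) has_real_derivative
        q * r * b + r ^ 4 * a\<^sup>2 * (lam - X) / 4 - 3 * r ^ 4 * b\<^sup>2 / 4) (at x)"
      using a r
      by (auto intro!: derivative_eq_intros dg' du du1 simp: a_def[symmetric] b_def[symmetric] G)
         (simp add: field_simps eval_nat_numeral)
    have d3: "((\<lambda>x. u x * u1 x / 4) has_real_derivative (b\<^sup>2 + a\<^sup>2 * (lam - X)) / 4) (at x)"
      by (auto intro!: derivative_eq_intros du du1 simp: a_def[symmetric] b_def[symmetric] power2_eq_square)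
    have d4: "((\<lambda>x. h * T x) has_real_derivative h * (1 / r\<^sup>2)) (at x)"
      by (rule DERIV_cmult[OF dT'])
    have d5: "((\<lambda>x. h * x) has_real_derivative h) (at x)"
      using DERIV_cmult[OF DERIV_ident, of h] by simp
    have dA: "(A has_real_derivative eU (T x) * (1 / r\<^sup>2) + h * (1 / r\<^sup>2) - eu x - h
        - (q * r * b + r ^ 4 * a\<^sup>2 * (lam - X) / 4 - 3 * r ^ 4 * b\<^sup>2 / 4)
        + (b\<^sup>2 + a\<^sup>2 * (lam - X)) / 4) (at x)"
      unfolding A_def
      by (intro DERIV_add DERIV_diff d1 d2 d3 d4 d5 dPu[OF x])
    have "eU (T x) * (1 / r\<^sup>2) = q\<^sup>2 / 2 / r\<^sup>2 - a\<^sup>2 * Y / p"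
      using gpos[of x] x gY a r unfolding eU_def g_def[symmetric] q_def[symmetric]
      by (simp add: G diff_divide_distrib) (simp add: field_simps)
    moreover have "eu x = b\<^sup>2 / 2 - a\<^sup>2 * X / p"
      using a aX by (simp add: eu_def a_def[symmetric] b_def[symmetric])
    ultimately have "eU (T x) * (1 / r\<^sup>2) + h * (1 / r\<^sup>2) - eu x - h
        - (q * r * b + r ^ 4 * a\<^sup>2 * (lam - X) / 4 - 3 * r ^ 4 * b\<^sup>2 / 4)
        + (b\<^sup>2 + a\<^sup>2 * (lam - X)) / 4
      = (q\<^sup>2 / 2 + h) / r\<^sup>2 - a\<^sup>2 * Y / p - (b\<^sup>2 / 2 - a\<^sup>2 * X / p + h)
      - (q * r * b + r ^ 4 * a\<^sup>2 * (lam - X) / 4 - 3 * r ^ 4 * b\<^sup>2 / 4) + (b\<^sup>2 + a\<^sup>2 * (lam - X)) / 4"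
      by (simp add: add_divide_distrib)
    also have "\<dots> = D x"
      using convexity_identity[OF _ r b2, of q Y] p
      by (simp add: D_def a_def b_def q_def r_def X_def Y_def)
    finally show ?thesis using dA by simp
  qed
  have D_parts: "D x \<ge> h * (1 / (g x / u x)\<^sup>2 + (g x / u x) ^ 4 / 2 - 3 / 2)" if x: "x \<in> {0<..<l}" for x
  proof -
    define r where "r = g x / u x"
    have a: "u x > 0" using upos[of x] x by simp
    have r: "r > 0" using gpos[of x] a x by (simp add: r_def)
    have "g x = r * u x" using a by (simp add: r_def)
    then have "g x powr (p - 2) = r powr (p - 2) * u x powr (p - 2)"
      using r a by (simp add: powr_mult)
    also have "\<dots> \<le> (1 + (p - 2) / 4 * (r ^ 4 - 1)) * u x powr (p - 2)"
      by (intro mult_right_mono powr_tangent_bound p r) simp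
    finally have "u x powr (p - 2) * (1 + (p - 2) / 4 * (r ^ 4 - 1)) - g x powr (p - 2) \<ge> 0"
      by (simp add: mult.commute)
    then have "(u x)\<^sup>2 / p * (u x powr (p - 2) * (1 + (p - 2) / 4 * (r ^ 4 - 1)) - g x powr (p - 2)) \<ge> 0"
      using p by (intro mult_nonneg_nonneg) auto
    then show ?thesis unfolding D_def r_def by simp
  qed
  have ratio: "g x / u x > 0" if "x \<in> {0<..<l}" for x
    using gpos[of x] upos[of x] that by simp
  have D_nonneg: "D x \<ge> 0" if "x \<in> {0<..<l}" for x
    using D_parts[OF that] pressure_tangent_bound(1)[OF ratio[OF that]] h
    by (meson mult_nonneg_nonneg order_trans less_imp_le)
  have A_mono: "A y \<le> A x" if "0 \<le> y" "y \<le> x" "x < l" for x y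
  proof (rule DERIV_nonneg_imp_increasing_open[OF that(2), where f=A])
    show "\<exists>d. (A has_real_derivative d) (at t) \<and> 0 \<le> d" if "y < t" "t < x" for t
      using dA[of t] D_nonneg[of t] that \<open>0 \<le> y\<close> \<open>x < l\<close> by auto
    have sub: "{y..x} \<subseteq> {0..l}" using that by auto
    have "T ` {y..x} \<subseteq> {0..l}" using T_in sub by blast
    then have "continuous_on {y..x} (\<lambda>x. PU (T x))"
      using continuous_on_compose2[OF cPU continuous_on_subset[OF cT sub]] by blast
    moreover have "u t \<noteq> 0" if "t \<in> {y..x}" for t
      using upos[of t] that \<open>0 \<le> y\<close> \<open>x < l\<close> by auto
    ultimately show "continuous_on {y..x} A" unfolding A_def
      by (intro continuous_intros continuous_on_subset[OF cT sub] continuous_on_subset[OF cPu sub]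
          continuous_on_subset[OF cg sub] continuous_on_subset[OF cu sub] continuous_on_subset[OF cu1 sub]) auto
  qed
  have A0: "A 0 = 0" using u10 m0 T0 by (simp add: A_def)

  obtain C where C: "C > 0" "\<And>x. x \<in> {0..l} \<Longrightarrow> \<bar>U1 x\<bar> \<le> C"
    using compact_imp_bounded[OF compact_continuous_image[OF cU1 compact_Icc]]
    unfolding bounded_pos by auto
  obtain K where K: "K > 0" "\<And>x. x \<in> {0..l} \<Longrightarrow> \<bar>u1 x\<bar> \<le> K"
    using compact_imp_bounded[OF compact_continuous_image[OF cu1 compact_Icc]]
    unfolding bounded_pos by auto
  \<comment> \<open>The boundary term \<open>g^4 u' / u^3\<close> is of the order of \<open>g\<close>: near the end both cubes are comparable with
    the remaining mass, since a profile of bounded slope is at most, and one of slope below \<open>-c\<close> at least,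
    of the order of the cube root of the mass that is left.\<close>
  have g_upper: "g x ^ 3 \<le> 3 * C * (mu l - mu x)" if x: "x \<in> {0..l}" for x
  proof -
    have "U y ^ 3 + 3 * C * mU y \<le> U l ^ 3 + 3 * C * mU l" if y: "y \<in> {0..l}" for y
    proof (rule DERIV_nonneg_imp_increasing_open[where f="\<lambda>y. U y ^ 3 + 3 * C * mU y"])
      show "y \<le> l" using y by simp
      show "continuous_on {y..l} (\<lambda>y. U y ^ 3 + 3 * C * mU y)"
        using y by (intro continuous_intros continuous_on_subset[OF cU] continuous_on_subset[OF cmU]) auto
      fix t assume "y < t" "t < l"
      then have t: "t \<in> {0<..<l}" using y by auto
      have "((\<lambda>y. U y ^ 3 + 3 * C * mU y) has_real_derivative 3 * (U t)\<^sup>2 * (U1 t + C)) (at t)"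
        by (auto intro!: derivative_eq_intros U'[OF t] dmU[OF t] simp: algebra_simps)
      moreover have "3 * (U t)\<^sup>2 * (U1 t + C) \<ge> 0"
        using C(2)[of t] t by (intro mult_nonneg_nonneg) auto
      ultimately show "\<exists>d. ((\<lambda>y. U y ^ 3 + 3 * C * mU y) has_real_derivative d) (at t) \<and> 0 \<le> d" by blast
    qed
    from this[OF T_in[OF x]] show ?thesis
      using mUT[OF x] ml by (simp add: Ul g_def algebra_simps)
  qed
  define c where "c = \<bar>u1 l\<bar> / 2"
  have "(u1 l)\<^sup>2 = 2 * h" using ham[of l] ul l by simp
  then have c: "c > 0" using h by (auto simp: c_def)
  obtain x0 where x0: "0 \<le> x0" "x0 < l" "\<And>x. x \<in> {x0..l} \<Longrightarrow> \<bar>u1 x - u1 l\<bar> < c"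
  proof -
    obtain d where d: "d > 0" "\<And>x. x \<in> {0..l} \<Longrightarrow> dist x l < d \<Longrightarrow> dist (u1 x) (u1 l) < c"
      using cu1 c l unfolding continuous_on_iff by (metis atLeastAtMost_iff less_imp_le order_refl)
    show ?thesis
      by (rule that[of "max 0 (l - d / 2)"]) (use d l in \<open>auto simp: dist_real_def\<close>)
  qed
  have u1l: "u1 l < 0"
  proof (rule ccontr)
    assume "\<not> ?thesis"
    have "u x0 \<le> u l"
    proof (rule DERIV_nonneg_imp_increasing_open[where f=u])
      fix t assume t: "x0 < t" "t < l"
      then have "u1 t \<ge> 0" using x0(3)[of t] \<open>\<not> u1 l < 0\<close> by (auto simp: c_def abs_if split: if_splits)
      then show "\<exists>d. (u has_real_derivative d) (at t) \<and> 0 \<le> d" using u'[of t] t x0 by auto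
    qed (use x0 cu in \<open>auto elim: continuous_on_subset\<close>)
    then show False using upos[of x0] x0 ul by auto
  qed
  have u_lower: "u x ^ 3 \<ge> 3 * c * (mu l - mu x)" if x: "x \<in> {x0..l}" for x
  proof -
    have "u x ^ 3 + 3 * c * mu x \<ge> u l ^ 3 + 3 * c * mu l"
    proof (rule DERIV_nonpos_imp_decreasing_open[where f="\<lambda>y. u y ^ 3 + 3 * c * mu y"])
      show "x \<le> l" using x by simp
      show "continuous_on {x..l} (\<lambda>y. u y ^ 3 + 3 * c * mu y)"
        using x x0 by (intro continuous_intros continuous_on_subset[OF cu] continuous_on_subset[OF cmu]) auto
      fix t assume t': "x < t" "t < l"
      then have t: "t \<in> {0<..<l}" using x x0 by auto
      have "((\<lambda>y. u y ^ 3 + 3 * c * mu y) has_real_derivative 3 * (u t)\<^sup>2 * (u1 t + c)) (at t)"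
        by (auto intro!: derivative_eq_intros u'[OF t] dmu[OF t] simp: algebra_simps)
      moreover have "3 * (u t)\<^sup>2 * (u1 t + c) \<le> 0"
        using x0(3)[of t] t' x u1l by (intro mult_nonneg_nonpos) (auto simp: c_def abs_if split: if_splits)
      ultimately show "\<exists>d. ((\<lambda>y. u y ^ 3 + 3 * c * mu y) has_real_derivative d) (at t) \<and> d \<le> 0" by blast
    qed
    then show ?thesis by (simp add: ul algebra_simps)
  qed
  \<comment> \<open>\<open>W\<close> bounds \<open>A\<close> near the end and, unlike \<open>A\<close>, is continuous up to the end.\<close>
  define W where "W x = PU (T x) + h * T x - Pu x - h * x + C / c * K / 4 * g x + u x * u1 x / 4" for x
  have A_le_W: "A x \<le> W x" if x: "x \<in> {x0..<l}" for x
  proof -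
    have u3: "u x ^ 3 > 0" using upos[of x] x x0 by auto
    have g0: "g x > 0" using gpos[of x] x x0 by auto
    have "g x ^ 3 \<le> C / c * (3 * c * (mu l - mu x))" using g_upper[of x] x x0 c by (simp add: algebra_simps)
    also have "\<dots> \<le> C / c * u x ^ 3"
      using u_lower[of x] x C(1) c by (intro mult_left_mono) auto
    finally have quot: "g x ^ 3 / u x ^ 3 \<le> C / c" using u3 by (simp add: pos_divide_le_eq)
    have "- u1 x \<le> K" using K(2)[of x] x x0(1) by auto
    then have "g x ^ 3 / u x ^ 3 * (g x * (- u1 x)) \<le> g x ^ 3 / u x ^ 3 * (g x * K)"
      using g0 u3 by (intro mult_left_mono) auto
    also have "\<dots> \<le> C / c * (g x * K)"
      using quot g0 K(1) by (intro mult_right_mono) auto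
    finally have "g x ^ 3 / u x ^ 3 * (g x * (- u1 x)) / 4 \<le> C / c * (g x * K) / 4"
      by (rule divide_right_mono) simp
    moreover have "g x ^ 3 / u x ^ 3 * (g x * (- u1 x)) / 4 = - (g x ^ 4 * u1 x / (4 * u x ^ 3))"
      by (simp add: eval_nat_numeral)
    ultimately have "- (g x ^ 4 * u1 x / (4 * u x ^ 3)) \<le> C / c * (g x * K) / 4"
      by linarith
    then have "- (g x ^ 4 * u1 x / (4 * u x ^ 3)) \<le> C / c * K / 4 * g x"
      by (simp add: mult_ac)
    then show ?thesis by (simp add: A_def W_def)
  qed
  have cW: "continuous_on {0..l} W"
    unfolding W_def
    by (intro continuous_intros cT cPu cg cu cu1 continuous_on_compose2[OF cPU cT]) (use T_in c in auto)
  have A_upper: "A y \<le> integral {0..l} eU - integral {0..l} eu" if y: "y \<in> {0..<l}" for y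
  proof -
    have "(W \<longlongrightarrow> W l) (at_left l)"
      using continuous_on_Icc_at_leftD[OF cW] l by simp
    moreover have "\<forall>\<^sub>F x in at_left l. A y \<le> W x"
    proof (rule eventually_mono[OF eventually_at_left_real])
      show "max x0 y < l" using x0 y by simp
      fix x assume "x \<in> {max x0 y<..<l}"
      then show "A y \<le> W x" using A_mono[of y x] A_le_W[of x] x0 y by auto
    qed
    ultimately have "A y \<le> W l"
      by (intro tendsto_lowerbound[of W]) auto
    then show ?thesis by (simp add: W_def Tl gl ul PU_def Pu_def)
  qed
  show "integral {0..l} eu \<le> integral {0..l} eU"
    using A_upper[of 0] A0 l by simp
  assume eq: "integral {0..l} eu = integral {0..l} eU" and x: "x \<in> {0..l}"
  have Azero: "A y = 0" if "y \<in> {0..<l}" for y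
    using A_upper[OF that] A_mono[of 0 y] A0 eq that by auto
  have gu: "g y = u y" if y: "y \<in> {0<..<l}" for y
  proof -
    have "\<forall>\<^sub>F t in nhds y. A t = 0"
      using eventually_nhds_in_open[of "{0<..<l}" y] y Azero by (auto elim: eventually_mono)
    then have "(A has_real_derivative 0) (at y)"
      by (subst DERIV_cong_ev[OF refl _ refl, of _ "\<lambda>_. 0"]) auto
    then have "D y = 0" using dA[OF y] DERIV_unique by blast
    then have "1 / (g y / u y)\<^sup>2 + (g y / u y) ^ 4 / 2 - 3 / 2 \<le> 0"
      using D_parts[OF y] h by (metis linorder_not_less mult_pos_pos)
    then have "g y / u y = 1"
      using pressure_tangent_bound[OF ratio[OF y]] by linarith
    then show ?thesis using upos[of y] y by simp
  qed
  have "T y - y = T 0 - 0" if "y \<in> {0..l}" for y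
  proof (rule DERIV_isconst2[OF l])
    show "continuous_on {0..l} (\<lambda>y. T y - y)" by (intro continuous_intros cT)
    fix t assume "0 < t" "t < l"
    then have t: "t \<in> {0<..<l}" by simp
    show "((\<lambda>y. T y - y) has_real_derivative 0) (at t)"
      using DERIV_diff[OF dT[OF t] DERIV_ident] gu[OF t] upos[of t] t by simp
  qed (use that in auto)
  then have Tid: "T y = y" if "y \<in> {0..l}" for y using T0 that by force
  have Uu: "U y - u y = 0" if "y \<in> {0<..<l}" for y
    using gu[OF that] Tid[of y] that by (simp add: g_def)
  have "U x - u x = 0"
  proof (rule continuous_constant_on_closure[of "{0<..<l}" "\<lambda>y. U y - u y"])
    show "continuous_on (closure {0<..<l}) (\<lambda>y. U y - u y)"
      using l by (simp add: closure_greaterThanLessThan) (intro continuous_intros cU cu)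
    show "x \<in> closure {0<..<l}" using x l by (simp add: closure_greaterThanLessThan)
  qed (use Uu in auto)
  then show "U x = u x" by simp
qed


section \<open>Existence of a solution with one zero\<close>

text \<open>
  The difference quotient of \<open>|s|^q\<close> between \<open>s\<close> and \<open>1\<close>, continued by the derivative \<open>q\<close> at \<open>s = 1\<close>. It
  removes the singularity of the period integral at the turning point.
\<close>

definition secant_slope :: "real \<Rightarrow> real \<Rightarrow> real" where
  "secant_slope q s = (if s = 1 then q else (\<bar>s\<bar> powr q - 1) / (s - 1))"

lemma secant_slope_mult: "secant_slope q s * (1 - s) = 1 - \<bar>s\<bar> powr q"
  by (auto simp: secant_slope_def field_simps)

lemma isCont_secant_slope:
  assumes "q > 1"
  shows "isCont (secant_slope q) s"
proof (cases "s = 1")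
  case True
  have "((\<lambda>y. (\<bar>y\<bar> powr q - \<bar>1\<bar> powr q) / (y - 1)) \<longlongrightarrow> q) (at 1)"
    using powr_abs_deriv[OF assms, of 1] unfolding has_field_derivative_iff by simp
  then have "(secant_slope q \<longlongrightarrow> q) (at 1)"
    by (rule Lim_transform_eventually) (auto simp: eventually_at_filter secant_slope_def)
  then show ?thesis using True by (simp add: isCont_def secant_slope_def)
next
  case False
  have "isCont (\<lambda>y. (\<bar>y\<bar> powr q - 1) / (y - 1)) s"
    using False assms by (intro continuous_intros isCont_abs_powr) auto
  moreover have "\<forall>\<^sub>F y in nhds s. (\<bar>y\<bar> powr q - 1) / (y - 1) = secant_slope q y"
    by (rule eventually_mono[OF eventually_nhds_in_open[of "- {1}" s]])
       (use False in \<open>auto simp: secant_slope_def\<close>)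
  ultimately show ?thesis using isCont_cong by fast
qed

text \<open>
  The lower bound is \<open>s^q \<le> s\<close>. The upper bound follows from \<open>s^q \<ge> s^3\<close> and
  \<open>s^3 - (2 s^2 - s) = s (1 - s)^2\<close>.
\<close>

lemma secant_slope_bounds:
  assumes q: "1 < q" "q < 3" and s: "0 \<le> s" "s \<le> 1"
  shows "1 \<le> secant_slope q s" "secant_slope q s \<le> 1 + 2 * s"
proof -
  have up: "s powr q \<le> s"
    using powr_mono'[of 1 q s] q s by (cases "s = 0") auto
  have "s ^ 3 \<le> s powr q"
    using powr_mono'[of q 3 s] q s by (cases "s = 0") (auto simp: powr_numeral)
  moreover have "s ^ 3 = s * (1 - s)\<^sup>2 + 2 * s\<^sup>2 - s" by (simp add: power2_eq_square power3_eq_cube algebra_simps)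
  ultimately have low: "2 * s\<^sup>2 - s \<le> s powr q"
    using s by (smt (verit) mult_nonneg_nonneg zero_le_power2)
  show "1 \<le> secant_slope q s"
  proof (cases "s = 1")
    case False
    then have "1 * (1 - s) \<le> secant_slope q s * (1 - s)" using up s secant_slope_mult[of q s] by simp
    then show ?thesis using False s by simp
  qed (use q in \<open>simp add: secant_slope_def\<close>)
  show "secant_slope q s \<le> 1 + 2 * s"
  proof (cases "s = 1")
    case False
    have "secant_slope q s * (1 - s) \<le> (1 + 2 * s) * (1 - s)"
      using low s secant_slope_mult[of q s] by (simp add: algebra_simps power2_eq_square)
    then show ?thesis using False s by simp
  qed (use q in \<open>simp add: secant_slope_def\<close>)
qed

text \<open>
  Inserting \<open>u = M cos \<theta>\<close> and \<open>lam = \<kappa> M^(p-2)\<close> into the Hamiltonian identity gives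
  \<open>\<theta>' = M^(p/2 - 1) * phase_speed p \<kappa> \<theta>\<close>; see \<open>sin_phase_speed\<close>. The condition \<open>\<kappa> < 2/p\<close> is the
  positivity of the Hamiltonian.
\<close>

definition phase_speed :: "real \<Rightarrow> real \<Rightarrow> real \<Rightarrow> real" where
  "phase_speed p \<kappa> \<theta> = sqrt (2 / p * secant_slope (p / 2) ((cos \<theta>)\<^sup>2) - \<kappa>)"

lemma phase_speed_bounds:
  assumes p: "2 < p" "p < 6" and \<kappa>: "\<kappa> < 2 / p"
  shows "sqrt (2 / p - \<kappa>) \<le> phase_speed p \<kappa> \<theta>"
    and "phase_speed p \<kappa> \<theta> \<le> sqrt (2 / p - \<kappa> + 2 * (cos \<theta>)\<^sup>2)"
    and "phase_speed p \<kappa> \<theta> > 0"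
proof -
  have c: "0 \<le> (cos \<theta>)\<^sup>2" "(cos \<theta>)\<^sup>2 \<le> 1" using abs_cos_le_one[of \<theta>] by (auto simp: abs_square_le_1)
  have "2 / p * 1 \<le> 2 / p * secant_slope (p / 2) ((cos \<theta>)\<^sup>2)"
    using secant_slope_bounds(1)[of "p / 2", OF _ _ c] p by (intro mult_left_mono) auto
  then show 1: "sqrt (2 / p - \<kappa>) \<le> phase_speed p \<kappa> \<theta>" by (simp add: phase_speed_def)
  have "2 / p * secant_slope (p / 2) ((cos \<theta>)\<^sup>2) \<le> 2 / p * (1 + 2 * (cos \<theta>)\<^sup>2)"
    using secant_slope_bounds(2)[of "p / 2", OF _ _ c] p by (intro mult_left_mono) auto
  also have "\<dots> = 2 / p + 2 / p * (2 * (cos \<theta>)\<^sup>2)" by (simp add: algebra_simps)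
  also have "\<dots> \<le> 2 / p + 1 * (2 * (cos \<theta>)\<^sup>2)"
    using p c by (intro add_left_mono mult_right_mono) auto
  finally show "phase_speed p \<kappa> \<theta> \<le> sqrt (2 / p - \<kappa> + 2 * (cos \<theta>)\<^sup>2)" by (simp add: phase_speed_def)
  have "sqrt (2 / p - \<kappa>) > 0" using \<kappa> by simp
  then show "phase_speed p \<kappa> \<theta> > 0" using 1 by linarith
qed

lemma continuous_on_phase_speed:
  fixes f g :: "'a::t2_space \<Rightarrow> real"
  assumes "p > 2" "continuous_on S f" "continuous_on S g"
  shows "continuous_on S (\<lambda>x. phase_speed p (f x) (g x))"
proof -
  have "continuous_on UNIV (secant_slope (p / 2))"
    using isCont_secant_slope[of "p / 2"] assms(1) by (simp add: continuous_on_eq_continuous_at)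
  then have "continuous_on S (\<lambda>x. secant_slope (p / 2) ((cos (g x))\<^sup>2))"
    by (rule continuous_on_compose2) (auto intro!: continuous_intros assms)
  then show ?thesis unfolding phase_speed_def by (intro continuous_intros assms)
qed

lemma sin_phase_speed:
  assumes p: "p > 2"
  shows "(sin \<theta>)\<^sup>2 * (2 / p * secant_slope (p / 2) ((cos \<theta>)\<^sup>2) - \<kappa>)
       = 2 / p * (1 - \<bar>cos \<theta>\<bar> powr p) - \<kappa> * (sin \<theta>)\<^sup>2"
proof -
  have s: "1 - (cos \<theta>)\<^sup>2 = (sin \<theta>)\<^sup>2" by (simp add: sin_squared_eq)
  have "secant_slope (p / 2) ((cos \<theta>)\<^sup>2) * (sin \<theta>)\<^sup>2 = 1 - ((cos \<theta>)\<^sup>2) powr (p / 2)"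
    using secant_slope_mult[of "p / 2" "(cos \<theta>)\<^sup>2"] unfolding s by simp
  also have "((cos \<theta>)\<^sup>2) powr (p / 2) = \<bar>cos \<theta>\<bar> powr p"
  proof -
    have "\<bar>cos \<theta>\<bar> powr 2 = (cos \<theta>)\<^sup>2" by (simp add: powr_numeral)
    moreover have "2 * (p / 2) = p" by simp
    ultimately show ?thesis using powr_powr[of "\<bar>cos \<theta>\<bar>" 2 "p / 2"] by metis
  qed
  finally have "2 / p * (secant_slope (p / 2) ((cos \<theta>)\<^sup>2) * (sin \<theta>)\<^sup>2) = 2 / p * (1 - \<bar>cos \<theta>\<bar> powr p)"
    by simp
  then show ?thesis by (simp add: algebra_simps)
qed

text \<open>
  The length of the interval on which \<open>\<theta>\<close> runs from \<open>0\<close> to \<open>\<pi>\<close> is \<open>M^(1 - p/2)\<close> times the transit time,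
  and the mass of \<open>M cos \<theta>\<close> on it is \<open>M^(3 - p/2)\<close> times the transit mass.
\<close>

definition transit_time :: "real \<Rightarrow> real \<Rightarrow> real" where
  "transit_time p \<kappa> = integral {0..pi} (\<lambda>\<theta>. 1 / phase_speed p \<kappa> \<theta>)"

definition transit_mass :: "real \<Rightarrow> real \<Rightarrow> real" where
  "transit_mass p \<kappa> = integral {0..pi} (\<lambda>\<theta>. (cos \<theta>)\<^sup>2 / phase_speed p \<kappa> \<theta>)"

lemma continuous_on_transit:
  assumes p: "2 < p" "p < 6"
  shows "continuous_on {..<2/p} (transit_time p)" "continuous_on {..<2/p} (transit_mass p)"
proof -
  have ps: "continuous_on ({..<2/p} \<times> cbox 0 pi) (\<lambda>x. phase_speed p (fst x) (snd x))"
    by (intro continuous_on_phase_speed p continuous_intros)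
  have nz: "phase_speed p (fst x) (snd x) \<noteq> 0" if "x \<in> {..<2/p} \<times> cbox 0 pi" for x
    using phase_speed_bounds(3)[OF p, of "fst x" "snd x"] that by auto
  have "continuous_on ({..<2/p} \<times> cbox 0 pi) (\<lambda>(\<kappa>, \<theta>). 1 / phase_speed p \<kappa> \<theta>)"
    unfolding case_prod_unfold using nz by (intro continuous_intros ps) auto
  from integral_continuous_on_param[OF this] show "continuous_on {..<2/p} (transit_time p)"
    by (simp add: transit_time_def[abs_def])
  have "continuous_on ({..<2/p} \<times> cbox 0 pi) (\<lambda>(\<kappa>, \<theta>). (cos \<theta>)\<^sup>2 / phase_speed p \<kappa> \<theta>)"
    unfolding case_prod_unfold using nz by (intro continuous_intros ps) auto
  from integral_continuous_on_param[OF this] show "continuous_on {..<2/p} (transit_mass p)"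
    by (simp add: transit_mass_def[abs_def])
qed

lemma
  assumes p: "2 < p" "p < 6" and \<kappa>: "\<kappa> < 2 / p"
  shows continuous_on_transit_time_integrand: "continuous_on S (\<lambda>\<theta>. 1 / phase_speed p \<kappa> \<theta>)"
    and continuous_on_transit_mass_integrand: "continuous_on S (\<lambda>\<theta>. (cos \<theta>)\<^sup>2 / phase_speed p \<kappa> \<theta>)"
proof -
  have ps: "continuous_on S (phase_speed p \<kappa>)"
    using continuous_on_phase_speed[of p S "\<lambda>_. \<kappa>" "\<lambda>x. x"] p by simp
  have nz: "phase_speed p \<kappa> x \<noteq> 0" for x
    using phase_speed_bounds(3)[OF p \<kappa>, of x] by simp
  show "continuous_on S (\<lambda>\<theta>. 1 / phase_speed p \<kappa> \<theta>)"
    "continuous_on S (\<lambda>\<theta>. (cos \<theta>)\<^sup>2 / phase_speed p \<kappa> \<theta>)"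
    using nz by (intro continuous_intros ps; simp)+
qed

lemma transit_upper:
  assumes p: "2 < p" "p < 6" and \<kappa>: "\<kappa> < 2 / p"
  shows "transit_time p \<kappa> \<le> pi / sqrt (2 / p - \<kappa>)" "transit_mass p \<kappa> \<le> transit_time p \<kappa>"
    and "0 \<le> transit_mass p \<kappa>"
proof -
  note int = continuous_on_transit_time_integrand[OF p \<kappa>, THEN integrable_continuous_real]
    continuous_on_transit_mass_integrand[OF p \<kappa>, THEN integrable_continuous_real]
  note b = phase_speed_bounds[OF p \<kappa>]
  have "transit_time p \<kappa> \<le> integral {0..pi} (\<lambda>_. 1 / sqrt (2 / p - \<kappa>))"
    unfolding transit_time_def using b \<kappa>
    by (intro integral_le int integrable_const_ivl) (auto intro!: divide_left_mono mult_pos_pos)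
  then show "transit_time p \<kappa> \<le> pi / sqrt (2 / p - \<kappa>)" by simp
  have "(cos \<theta>)\<^sup>2 \<le> 1" for \<theta> :: real using abs_cos_le_one[of \<theta>] by (simp add: abs_square_le_1)
  then show "transit_mass p \<kappa> \<le> transit_time p \<kappa>"
    unfolding transit_mass_def transit_time_def using b(3)
    by (intro integral_le int divide_right_mono) (auto simp: less_imp_le)
  show "0 \<le> transit_mass p \<kappa>"
    unfolding transit_mass_def using b(3) by (intro integral_nonneg int) (auto simp: less_imp_le)
qed

text \<open>
  The transit time diverges as \<open>\<kappa>\<close> tends to \<open>2/p\<close>, since the phase slows down near \<open>\<theta> = \<pi>/2\<close>: with
  \<open>e = sqrt (2/p - \<kappa>)\<close> the speed is at most \<open>e + 2 (\<pi>/2 - \<theta>)\<close> on \<open>[0, \<pi>/2]\<close>, and the reciprocal of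
  this bound has a logarithmic integral.
\<close>

lemma transit_time_lower:
  assumes p: "2 < p" "p < 6" and \<kappa>: "\<kappa> < 2 / p"
  shows "transit_time p \<kappa> \<ge> - ln (sqrt (2 / p - \<kappa>)) / 2"
proof -
  define e where "e = sqrt (2 / p - \<kappa>)"
  have e: "e > 0" using \<kappa> by (simp add: e_def)
  have e2: "e\<^sup>2 = 2 / p - \<kappa>" using \<kappa> by (simp add: e_def)
  define f where "f \<theta> = 1 / (e + 2 * (pi / 2 - \<theta>))" for \<theta>
  have "(f has_integral - ln (e + 2 * (pi / 2 - pi / 2)) / 2 - (- ln (e + 2 * (pi / 2 - 0)) / 2)) {0..pi/2}"
  proof (rule fundamental_theorem_of_calculus)
    fix x assume x: "x \<in> {0..pi/2}"
    have "((\<lambda>\<theta>. - ln (e + 2 * (pi / 2 - \<theta>)) / 2) has_real_derivative f x) (at x within {0..pi/2})"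
      unfolding f_def using x e by (auto intro!: derivative_eq_intros simp: field_simps)
    then show "((\<lambda>\<theta>. - ln (e + 2 * (pi / 2 - \<theta>)) / 2) has_vector_derivative f x) (at x within {0..pi/2})"
      by (simp add: has_real_derivative_iff_has_vector_derivative)
  qed simp
  then have f: "f integrable_on {0..pi/2}" "integral {0..pi/2} f = ln (e + pi) / 2 - ln e / 2"
    by (auto simp: integrable_on_def integral_unique)
  note int = continuous_on_transit_time_integrand[OF p \<kappa>, THEN integrable_continuous_real]
  note b = phase_speed_bounds[OF p \<kappa>]
  have le: "f x \<le> 1 / phase_speed p \<kappa> x" if x: "x \<in> {0..pi/2}" for x
  proof -
    have "cos x = sin (pi / 2 - x)" by (simp add: sin_diff)
    then have "\<bar>cos x\<bar> \<le> pi / 2 - x" using abs_sin_x_le_abs_x[of "pi / 2 - x"] x by simp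
    then have "(cos x)\<^sup>2 \<le> (pi / 2 - x)\<^sup>2" by (metis abs_le_square_iff abs_ge_self order_trans)
    moreover have "e\<^sup>2 + 2 * y\<^sup>2 \<le> (e + 2 * y)\<^sup>2" if "y \<ge> 0" for y
    proof -
      have "(e + 2 * y)\<^sup>2 = e\<^sup>2 + 4 * (e * y) + 4 * y\<^sup>2"
        by (simp add: power2_eq_square algebra_simps)
      then show ?thesis using mult_nonneg_nonneg[of e y] e that by simp
    qed
    ultimately have "e\<^sup>2 + 2 * (cos x)\<^sup>2 \<le> (e + 2 * (pi / 2 - x))\<^sup>2"
      using x by (smt (verit, ccfv_threshold) atLeastAtMost_iff)
    then have "sqrt (e\<^sup>2 + 2 * (cos x)\<^sup>2) \<le> e + 2 * (pi / 2 - x)"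
      using e x by (intro real_le_lsqrt) auto
    then have "phase_speed p \<kappa> x \<le> e + 2 * (pi / 2 - x)"
      using b(2)[of x] unfolding e2 by linarith
    then show ?thesis unfolding f_def using b(3)[of x] by (intro divide_left_mono) auto
  qed
  have "ln (e + pi) \<ge> 0" using e pi_gt3 by (intro ln_ge_zero) auto
  then have "- ln e / 2 \<le> integral {0..pi/2} f" using f(2) by simp
  also have "\<dots> \<le> integral {0..pi/2} (\<lambda>\<theta>. 1 / phase_speed p \<kappa> \<theta>)"
    by (intro integral_le f int le)
  also have "\<dots> \<le> transit_time p \<kappa>" unfolding transit_time_def
    using b(3) by (intro integral_subset_le int) (auto simp: less_imp_le)
  finally show ?thesis by (simp add: e_def)
qed

lemma transit_mass_lower:
  assumes p: "2 < p" "p < 6" and \<kappa>: "0 \<le> \<kappa>" "\<kappa> < 2 / p"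
  shows "transit_mass p \<kappa> \<ge> 1 / 2"
proof -
  note b = phase_speed_bounds[OF p \<kappa>(2)]
  have "((\<lambda>\<theta>. (cos \<theta>)\<^sup>2 / 2) has_integral (pi / 2 + sin pi * cos pi / 2) / 2 - (0 / 2 + sin 0 * cos 0 / 2) / 2) {0..pi}"
  proof (rule fundamental_theorem_of_calculus)
    fix x :: real assume "x \<in> {0..pi}"
    have eq: "(cos x)\<^sup>2 = 1 / 2 + (cos x * cos x - sin x * sin x) / 2"
      using sin_cos_squared_add[of x] by (simp add: power2_eq_square field_simps)
    have "((\<lambda>x. (x / 2 + sin x * cos x / 2) / 2) has_real_derivative (cos x)\<^sup>2 / 2) (at x within {0..pi})"
      unfolding eq by (auto intro!: derivative_eq_intros simp: field_simps)
    then show "((\<lambda>x. (x / 2 + sin x * cos x / 2) / 2) has_vector_derivative (cos x)\<^sup>2 / 2) (at x within {0..pi})"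
      by (simp add: has_real_derivative_iff_has_vector_derivative)
  qed simp
  then have hi: "((\<lambda>\<theta>. (cos \<theta>)\<^sup>2 / 2) has_integral pi / 4) {0..pi}" by simp
  note f = has_integral_integrable[OF hi] integral_unique[OF hi]
  have "phase_speed p \<kappa> \<theta> \<le> 2" for \<theta>
  proof -
    have "(cos \<theta>)\<^sup>2 \<le> 1" using abs_cos_le_one[of \<theta>] by (simp add: abs_square_le_1)
    moreover have "2 / p \<le> 1" using p by simp
    ultimately have "2 / p - \<kappa> + 2 * (cos \<theta>)\<^sup>2 \<le> 2\<^sup>2" using \<kappa> by simp
    then show ?thesis using b(2)[of \<theta>] real_le_lsqrt order_trans by (metis zero_le_numeral)
  qed
  then have "(cos \<theta>)\<^sup>2 / 2 \<le> (cos \<theta>)\<^sup>2 / phase_speed p \<kappa> \<theta>" for \<theta>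
    using b(3)[of \<theta>] by (intro divide_left_mono) auto
  then have "integral {0..pi} (\<lambda>\<theta>. (cos \<theta>)\<^sup>2 / 2) \<le> transit_mass p \<kappa>"
    unfolding transit_mass_def
    by (intro integral_le f continuous_on_transit_mass_integrand[OF p \<kappa>(2), THEN integrable_continuous_real])
  then show ?thesis using f(2) pi_gt3 by simp
qed

text \<open>
  For length \<open>1\<close> the amplitude is \<open>M = transit_time^(2/(p-2))\<close>, and the left side of the equation is the
  resulting mass. Its exponent is positive since \<open>p < 6\<close>, so that the bounds on transit time and transit
  mass make it small for \<open>\<kappa>\<close> near \<open>-\<infinity>\<close> and large for \<open>\<kappa>\<close> near \<open>2/p\<close>.
\<close>

lemma transit_attains_mass:
  assumes p: "2 < p" "p < 6" and \<mu>: "\<mu> > 0"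
  obtains \<kappa> where "\<kappa> < 2 / p" "transit_time p \<kappa> powr ((6 - p) / (p - 2)) * transit_mass p \<kappa> = \<mu>"
proof -
  define \<alpha> where "\<alpha> = (6 - p) / (p - 2)"
  have \<alpha>: "\<alpha> > 0" using p by (simp add: \<alpha>_def)
  define G where "G \<kappa> = transit_time p \<kappa> powr \<alpha> * transit_mass p \<kappa>" for \<kappa>
  \<comment> \<open>\<open>\<kappa>1\<close> is so negative that both transit quantities are at most \<open>\<delta>\<close>, where \<open>\<delta>^(\<alpha> + 1) = \<mu>\<close>.\<close>
  define \<delta> where "\<delta> = \<mu> powr (1 / (\<alpha> + 1))"
  have \<delta>: "\<delta> > 0" using \<mu> by (simp add: \<delta>_def)
  define e1 where "e1 = max (pi / \<delta>) (sqrt (2 / p))"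
  define \<kappa>1 where "\<kappa>1 = 2 / p - e1\<^sup>2"
  have e1: "e1 > 0" "pi / \<delta> \<le> e1" "2 / p \<le> e1\<^sup>2"
    using \<delta> p by (auto simp: e1_def less_max_iff_disj real_sqrt_le_iff intro!: sqrt_le_D)
  have \<kappa>1: "\<kappa>1 \<le> 0" "\<kappa>1 < 2 / p" using e1 by (auto simp: \<kappa>1_def)
  have "transit_time p \<kappa>1 \<le> pi / e1" using transit_upper(1)[OF p \<kappa>1(2)] e1 by (simp add: \<kappa>1_def)
  also have "\<dots> \<le> \<delta>" using e1 \<delta> by (simp add: field_simps)
  finally have t1: "transit_time p \<kappa>1 \<le> \<delta>" .
  have "G \<kappa>1 \<le> \<delta> powr \<alpha> * \<delta>" unfolding G_def
    using t1 transit_upper[OF p \<kappa>1(2)] \<alpha>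
    by (intro mult_mono powr_mono2) auto
  also have "\<dots> = \<delta> powr (\<alpha> + 1)" using \<delta> by (simp add: powr_add)
  also have "\<dots> = \<mu>" using \<alpha> \<mu> by (simp add: \<delta>_def powr_powr)
  finally have G1: "G \<kappa>1 \<le> \<mu>" .
  \<comment> \<open>\<open>\<kappa>2\<close> is so close to \<open>2/p\<close> that the transit time is at least \<open>L\<close>, where \<open>L^\<alpha> / 2 = \<mu>\<close>.\<close>
  define L where "L = (2 * \<mu>) powr (1 / \<alpha>)"
  have L: "L > 0" using \<mu> by (simp add: L_def)
  define e2 where "e2 = min (sqrt (2 / p)) (exp (- 2 * L))"
  define \<kappa>2 where "\<kappa>2 = 2 / p - e2\<^sup>2"
  have e2: "e2 > 0" "e2 \<le> exp (- 2 * L)" "e2 \<le> sqrt (2 / p)" using p by (auto simp: e2_def)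
  have "e2\<^sup>2 \<le> 2 / p" using power_mono[OF e2(3), of 2] e2 p by simp
  then have \<kappa>2: "0 \<le> \<kappa>2" "\<kappa>2 < 2 / p" using e2 by (auto simp: \<kappa>2_def)
  have "ln e2 \<le> - 2 * L" using e2 by (metis ln_exp ln_le_cancel_iff exp_gt_zero)
  then have t2: "L \<le> transit_time p \<kappa>2"
    using transit_time_lower[OF p \<kappa>2(2)] e2 by (simp add: \<kappa>2_def)
  have "\<mu> = L powr \<alpha> * (1 / 2)" using \<alpha> \<mu> by (simp add: L_def powr_powr)
  also have "\<dots> \<le> G \<kappa>2" unfolding G_def
    using t2 L transit_mass_lower[OF p \<kappa>2] \<alpha> by (intro mult_mono powr_mono2) auto
  finally have G2: "\<mu> \<le> G \<kappa>2" .
  have sub: "{\<kappa>1..\<kappa>2} \<subseteq> {..<2/p}" using \<kappa>2 by auto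
  have c: "continuous_on {\<kappa>1..\<kappa>2} (transit_time p)" "continuous_on {\<kappa>1..\<kappa>2} (transit_mass p)"
    using continuous_on_transit[OF p] continuous_on_subset sub by blast+
  have nn: "0 \<le> transit_time p x" if "x \<in> {\<kappa>1..\<kappa>2}" for x
    using transit_upper(2,3)[OF p, of x] that \<kappa>2 by simp
  have "continuous_on {\<kappa>1..\<kappa>2} G"
    unfolding G_def by (intro continuous_on_mult continuous_on_powr' c continuous_on_const) (use nn \<alpha> in auto)
  then obtain \<kappa> where "\<kappa>1 \<le> \<kappa>" "\<kappa> \<le> \<kappa>2" "G \<kappa> = \<mu>"
    using IVT'[of G \<kappa>1 \<mu> \<kappa>2] G1 G2 \<kappa>1 \<kappa>2 by auto
  then show ?thesis using that[of \<kappa>] \<kappa>2 by (simp add: G_def \<alpha>_def)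
qed


text \<open>
  The position \<open>X\<close> is an integral of the reciprocal speed over the phase, and its inverse \<open>\<Theta>\<close> gives
  \<open>u = M cos \<Theta>\<close>, whose only zero is at phase \<open>\<pi>/2\<close>. The phase interval is taken larger than
  \<open>[0, \<pi>]\<close> so that \<open>\<Theta>\<close> is differentiable at both end points of \<open>[0, 1]\<close>.
\<close>

lemma nodal_solution_exists:
  assumes p: "2 < p" "p < 6" and \<mu>: "\<mu> > 0"
  obtains lam u u1 z where "nls_on p lam 0 1 u u1" "u1 0 = 0" "u1 1 = 0" "u 0 > 0" "u 1 < 0"
    "\<forall>x\<in>{0..1}. u x = 0 \<longrightarrow> x = z"
    "integral {0..1} (\<lambda>x. (u x)\<^sup>2) = \<mu>"
proof -
  obtain \<kappa> where \<kappa>: "\<kappa> < 2 / p"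
    and mass: "transit_time p \<kappa> powr ((6 - p) / (p - 2)) * transit_mass p \<kappa> = \<mu>"
    using transit_attains_mass[OF p \<mu>] .
  define w where "w = phase_speed p \<kappa>"
  have w: "w \<theta> > 0" for \<theta> unfolding w_def by (rule phase_speed_bounds(3)[OF p \<kappa>])
  note ct = continuous_on_transit_time_integrand[OF p \<kappa>, folded w_def]
  note cm = continuous_on_transit_mass_integrand[OF p \<kappa>, folded w_def]
  have cw: "continuous_on S w" for S
    unfolding w_def using continuous_on_phase_speed[of p S "\<lambda>_. \<kappa>" "\<lambda>x. x"] p by simp
  define N where "N = transit_time p \<kappa>"
  define m where "m = transit_mass p \<kappa>"
  have N: "N > 0"
  proof -
    have "N \<ge> 0" using transit_upper(2,3)[OF p \<kappa>] by (simp add: N_def)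
    moreover have "N \<noteq> 0" using mass \<mu> by (auto simp: N_def)
    ultimately show ?thesis by simp
  qed
  define M where "M = N powr (2 / (p - 2))"
  have M: "M > 0" using N by (simp add: M_def)
  have N2: "N\<^sup>2 = M powr (p - 2)"
  proof -
    have "2 / (p - 2) * (p - 2) = 2" using p by (simp add: field_simps)
    then have "M powr (p - 2) = N powr 2" unfolding M_def powr_powr by simp
    then show ?thesis using N by (simp add: powr_numeral)
  qed
  have M2: "M\<^sup>2 / N * m = \<mu>"
  proof -
    have "M\<^sup>2 = M powr 2" using M by (simp add: powr_numeral)
    also have "\<dots> = N powr (4 / (p - 2))" by (simp add: M_def powr_powr)
    finally have "M\<^sup>2 / N = N powr (4 / (p - 2) - 1)" using N by (simp add: powr_diff)
    also have "4 / (p - 2) - 1 = (6 - p) / (p - 2)" using p by (simp add: field_simps)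
    finally show ?thesis using mass by (simp add: N_def m_def)
  qed

  define primi where "primi f \<theta> = integral {-1..\<theta>} f - integral {-1..0} f" for f :: "real \<Rightarrow> real" and \<theta>
  have primi: "(primi f has_real_derivative f \<theta>) (at \<theta>)" if "continuous_on {-1..pi+1} f" "\<theta> \<in> {-1<..<pi+1}" for f \<theta>
  proof -
    have "((\<lambda>x. integral {-1..x} f) has_real_derivative f \<theta>) (at \<theta> within {-1..pi+1})"
      using integral_has_real_derivative[OF that(1), of \<theta>] that(2) by auto
    then have "((\<lambda>x. integral {-1..x} f) has_real_derivative f \<theta>) (at \<theta>)"
      using that(2) at_within_interior[of \<theta> "{-1..pi+1}"] by auto
    from DERIV_diff[OF this DERIV_const[of "integral {-1..0} f"]] show ?thesis by (simp add: primi_def[abs_def])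
  qed
  have primi_pi: "primi f pi = integral {0..pi} f" if "continuous_on {-1..pi+1} f" for f
    unfolding primi_def using pi_gt_zero
    by (subst Henstock_Kurzweil_Integration.integral_combine[of "-1" 0 pi f, symmetric])
       (auto intro!: integrable_continuous_real continuous_on_subset[OF that])
  have primi_cont: "continuous_on {-1..pi+1} (primi f)" if "continuous_on {-1..pi+1} f" for f
    unfolding primi_def
    by (intro continuous_intros indefinite_integral_continuous_1 integrable_continuous_real that)
  have primi0: "primi f 0 = 0" for f by (simp add: primi_def)
  define X where "X \<theta> = primi (\<lambda>\<theta>. 1 / w \<theta>) \<theta> / N" for \<theta>
  have X01: "X 0 = 0" "X pi = 1"
    using N unfolding X_def primi0 primi_pi[OF ct] by (auto simp: N_def transit_time_def w_def)
  have dX: "(X has_real_derivative 1 / (N * w \<theta>)) (at \<theta>)" if "\<theta> \<in> {-1<..<pi+1}" for \<theta>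
    unfolding X_def using DERIV_cdivide[OF primi[OF ct that], of N] by (simp add: mult.commute)
  have cX: "continuous_on {-1..pi+1} X" unfolding X_def using N by (intro continuous_intros primi_cont ct) auto
  have lt: "-1 < pi + 1" using pi_gt_zero by linarith
  have Xpos: "1 / (N * w \<theta>) > 0" for \<theta> using N w by simp
  obtain \<Theta> where \<Theta>: "continuous_on {X (-1)..X (pi+1)} \<Theta>"
    "\<forall>x\<in>{-1..pi+1}. X x \<in> {X (-1)..X (pi+1)} \<and> \<Theta> (X x) = x"
    "\<forall>y\<in>{X (-1)..X (pi+1)}. \<Theta> y \<in> {-1..pi+1} \<and> X (\<Theta> y) = y"
    "\<forall>y\<in>{X (-1)<..<X (pi+1)}. \<Theta> y \<in> {-1<..<pi+1} \<and> (\<Theta> has_real_derivative inverse (1 / (N * w (\<Theta> y)))) (at y)"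
    using increasing_inverse[OF lt cX dX Xpos] by blast
  have \<Theta>01: "\<Theta> 0 = 0" "\<Theta> 1 = pi"
    using bspec[OF \<Theta>(2), of 0] bspec[OF \<Theta>(2), of pi] X01 pi_gt_zero by auto
  have strict: "X (-1) < 0" "1 < X (pi + 1)"
  proof -
    have "\<Theta> (X (-1)) = -1" "\<Theta> (X (pi+1)) = pi + 1" using \<Theta>(2) lt by auto
    then have "X (-1) \<noteq> 0" "X (pi + 1) \<noteq> 1" using \<Theta>01 pi_gt_zero by auto
    moreover have "X (-1) \<le> 0" "1 \<le> X (pi + 1)"
      using bspec[OF \<Theta>(2), of 0] bspec[OF \<Theta>(2), of pi] X01 pi_gt_zero by auto
    ultimately show "X (-1) < 0" "1 < X (pi + 1)" by auto
  qed
  have d\<Theta>: "(\<Theta> has_real_derivative N * w (\<Theta> y)) (at y)" and \<Theta>_in: "\<Theta> y \<in> {-1<..<pi+1}" and X\<Theta>: "X (\<Theta> y) = y"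
    if "y \<in> {0..1}" for y
    using bspec[OF \<Theta>(4), of y] bspec[OF \<Theta>(3), of y] strict that by auto
  have \<Theta>_less: "\<Theta> x < \<Theta> y" if "0 \<le> x" "x < y" "y \<le> 1" for x y
  proof (rule DERIV_pos_imp_increasing[OF that(2)])
    fix t assume "x \<le> t" "t \<le> y"
    then have "(\<Theta> has_real_derivative N * w (\<Theta> t)) (at t)" using d\<Theta>[of t] that by simp
    then show "\<exists>d. (\<Theta> has_real_derivative d) (at t) \<and> 0 < d"
      using N w[of "\<Theta> t"] mult_pos_pos by blast
  qed
  have \<Theta>_open: "\<Theta> y \<in> {0<..<pi}" if "y \<in> {0<..<1}" for y
    using \<Theta>_less[of 0 y] \<Theta>_less[of y 1] \<Theta>01 that by auto
  have c\<Theta>: "continuous_on {0..1} \<Theta>"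
    using d\<Theta> DERIV_isCont by (blast intro: continuous_at_imp_continuous_on)

  define u where "u x = M * cos (\<Theta> x)" for x
  define u1 where "u1 x = - (M * N) * (sin (\<Theta> x) * w (\<Theta> x))" for x
  define lam where "lam = \<kappa> * N\<^sup>2"
  have du: "(u has_real_derivative u1 x) (at x)" if "x \<in> {0..1}" for x
    unfolding u_def u1_def by (auto intro!: derivative_eq_intros d\<Theta>[OF that] simp: mult_ac)
  have cu1: "continuous_on {0..1} u1"
    unfolding u1_def by (intro continuous_intros c\<Theta> continuous_on_compose2[OF cw[of UNIV] c\<Theta>]) auto
  have du1: "(u1 has_real_derivative lam * u x - \<bar>u x\<bar> powr (p - 2) * u x) (at x)" if x: "x \<in> {0<..<1}" for x
  proof -
    \<comment> \<open>The speed need not be differentiable in the phase, but its product with the sine is: it is \<open>sqrt Q\<close>,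
      and \<open>Q\<close> is smooth enough and positive on \<open>(0, \<pi>)\<close>.\<close>
    define Q where "Q \<theta> = 2 / p * (1 - \<bar>cos \<theta>\<bar> powr p) - \<kappa> * (sin \<theta>)\<^sup>2" for \<theta>
    have Qw: "sqrt (Q \<theta>) = sin \<theta> * w \<theta>" if "sin \<theta> > 0" for \<theta>
    proof -
      have "Q \<theta> = (sin \<theta>)\<^sup>2 * (2 / p * secant_slope (p / 2) ((cos \<theta>)\<^sup>2) - \<kappa>)"
        using sin_phase_speed[OF p(1)] by (simp add: Q_def)
      then show ?thesis using that by (simp add: real_sqrt_mult w_def phase_speed_def)
    qed
    have sinpos: "sin (\<Theta> y) > 0" if "y \<in> {0<..<1}" for y
      using \<Theta>_open[OF that] by (auto intro: sin_gt_zero)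
    have xi: "x \<in> {0..1}" using x by simp
    define s c W where "s = sin (\<Theta> x)" and "c = cos (\<Theta> x)" and "W = w (\<Theta> x)"
    have sW: "s > 0" "W > 0" using sinpos[OF x] w by (auto simp: s_def W_def)
    have dcos: "((\<lambda>\<theta>. \<bar>cos \<theta>\<bar> powr p) has_real_derivative p * (\<bar>c\<bar> powr (p - 2) * c) * (- s)) (at (\<Theta> x))"
      unfolding c_def s_def using p by (intro DERIV_chain2[OF powr_abs_deriv]) (auto intro!: derivative_eq_intros)
    have "(Q has_real_derivative 2 / p * (0 - p * (\<bar>c\<bar> powr (p - 2) * c) * (- s)) - \<kappa> * (2 * s * c)) (at (\<Theta> x))"
      unfolding Q_def
      by (intro DERIV_diff DERIV_cmult dcos DERIV_const) (auto intro!: derivative_eq_intros simp: s_def c_def)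
    then have dQ: "(Q has_real_derivative 2 * s * c * (\<bar>c\<bar> powr (p - 2) - \<kappa>)) (at (\<Theta> x))"
      using p by (simp add: algebra_simps)
    have Qx: "sqrt (Q (\<Theta> x)) = s * W" using Qw[OF sinpos[OF x]] by (simp add: s_def W_def)
    then have Qpos: "Q (\<Theta> x) > 0" using sW by (metis mult_pos_pos real_sqrt_gt_0_iff)
    have "((\<lambda>y. sqrt (Q (\<Theta> y))) has_real_derivative
        inverse (sqrt (Q (\<Theta> x))) / 2 * (2 * s * c * (\<bar>c\<bar> powr (p - 2) - \<kappa>) * (N * W))) (at x)"
      using DERIV_chain2[OF DERIV_real_sqrt[OF Qpos] DERIV_chain2[OF dQ d\<Theta>[OF xi]]] by (simp add: W_def)
    moreover have "inverse (sqrt (Q (\<Theta> x))) / 2 * (2 * s * c * (\<bar>c\<bar> powr (p - 2) - \<kappa>) * (N * W))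
        = N * c * (\<bar>c\<bar> powr (p - 2) - \<kappa>)"
      unfolding Qx using sW by (simp add: field_simps)
    ultimately have "((\<lambda>y. sqrt (Q (\<Theta> y))) has_real_derivative N * c * (\<bar>c\<bar> powr (p - 2) - \<kappa>)) (at x)"
      by (rule DERIV_cong)
    then have "((\<lambda>y. - (M * N) * sqrt (Q (\<Theta> y))) has_real_derivative
        - (M * N) * (N * c * (\<bar>c\<bar> powr (p - 2) - \<kappa>))) (at x)"
      by (rule DERIV_cmult)
    moreover have "- (M * N) * (N * c * (\<bar>c\<bar> powr (p - 2) - \<kappa>)) = lam * u x - \<bar>u x\<bar> powr (p - 2) * u x"
    proof -
      have "\<bar>u x\<bar> powr (p - 2) = N\<^sup>2 * \<bar>c\<bar> powr (p - 2)"
        using M by (simp add: u_def c_def abs_mult powr_mult N2)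
      then show ?thesis by (simp add: lam_def u_def c_def algebra_simps power2_eq_square)
    qed
    ultimately have "((\<lambda>y. - (M * N) * sqrt (Q (\<Theta> y))) has_real_derivative
        lam * u x - \<bar>u x\<bar> powr (p - 2) * u x) (at x)" by (rule DERIV_cong)
    then show ?thesis
      by (rule has_field_derivative_transform_within_open[of _ _ _ "{0<..<1}"])
         (use x Qw sinpos in \<open>auto simp: u1_def\<close>)
  qed
  have "nls_on p lam 0 1 u u1"
    unfolding nls_on_def
  proof (intro conjI ballI)
    show "(u has_real_derivative u1 x) (at x within {0..1})" if "x \<in> {0..1}" for x
      using du[OF that] by (rule has_field_derivative_at_within)
  qed (use du1 cu1 in simp_all)
  moreover have "u1 0 = 0" "u1 1 = 0" "u 0 > 0" "u 1 < 0"
    using \<Theta>01 M by (simp_all add: u_def u1_def)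
  moreover have "\<forall>x\<in>{0..1}. u x = 0 \<longrightarrow> x = X (pi / 2)"
  proof (intro ballI impI)
    fix x :: real assume x: "x \<in> {0..1}" and 0: "u x = 0"
    have "\<Theta> x \<in> {0..pi}"
      using \<Theta>_less[of 0 x] \<Theta>_less[of x 1] \<Theta>01 x by (cases "x = 0"; cases "x = 1") auto
    moreover have "cos (\<Theta> x) = cos (pi / 2)" using 0 M by (simp add: u_def)
    ultimately have "\<Theta> x = pi / 2" using cos_inj_pi[of "\<Theta> x" "pi / 2"] by simp
    then show "x = X (pi / 2)" using X\<Theta>[OF x] by metis
  qed
  moreover have "integral {0..1} (\<lambda>x. (u x)\<^sup>2) = \<mu>"
  proof -
    define Y where "Y \<theta> = M\<^sup>2 / N * primi (\<lambda>\<theta>. (cos \<theta>)\<^sup>2 / w \<theta>) \<theta>" for \<theta>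
    have "((\<lambda>x. (u x)\<^sup>2) has_integral Y (\<Theta> 1) - Y (\<Theta> 0)) {0..1}"
    proof (rule fundamental_theorem_of_calculus)
      fix x :: real assume x: "x \<in> {0..1}"
      have "((\<lambda>x. Y (\<Theta> x)) has_real_derivative M\<^sup>2 / N * ((cos (\<Theta> x))\<^sup>2 / w (\<Theta> x)) * (N * w (\<Theta> x))) (at x)"
        unfolding Y_def by (intro DERIV_chain2[OF DERIV_cmult[OF primi[OF cm \<Theta>_in[OF x]]] d\<Theta>[OF x]])
      moreover have "M\<^sup>2 / N * ((cos (\<Theta> x))\<^sup>2 / w (\<Theta> x)) * (N * w (\<Theta> x)) = (u x)\<^sup>2"
        using N w[of "\<Theta> x"] by (simp add: u_def power_mult_distrib)
      ultimately show "((\<lambda>x. Y (\<Theta> x)) has_vector_derivative (u x)\<^sup>2) (at x within {0..1})"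
        by (metis has_real_derivative_iff_has_vector_derivative has_vector_derivative_at_within)
    qed simp
    then have "integral {0..1} (\<lambda>x. (u x)\<^sup>2) = M\<^sup>2 / N * m"
      unfolding Y_def \<Theta>01 primi0 primi_pi[OF cm] by (simp add: integral_unique m_def transit_mass_def w_def)
    then show ?thesis using M2 by simp
  qed
  ultimately show ?thesis by (rule that)
qed


section \<open>Uniqueness of the least energy solution\<close>

lemma set_lebesgue_integral_unit_interval:
  fixes f g :: "real \<Rightarrow> real"
  assumes g: "continuous_on {0..1} g" and eq: "\<And>x. x \<in> {0<..<1} \<Longrightarrow> f x = g x"
  shows "(LINT x:{0<..<1}|lborel. f x) = integral {0..1} g"
proof -
  have "(LINT x:{0<..<1}|lborel. f x) = (LINT x:{0<..<1}|lborel. g x)"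
    by (rule set_lebesgue_integral_cong) (use eq in auto)
  also have "\<dots> = integral {0<..<1} g"
    by (intro set_borel_integral_eq_integral(2) set_integrable_subset[OF borel_integrable_atLeastAtMost'[OF g]]) auto
  also have "\<dots> = integral {0..1} g" by (rule integral_open_interval_real[symmetric])
  finally show ?thesis .
qed

lemma nls_on_norms:
  assumes p: "p > 2" and sol: "nls_on p lam 0 1 u u1"
  shows "(Lp_norm 2 u)\<^sup>2 = integral {0..1} (\<lambda>x. (u x)\<^sup>2)"
    and "energy p u = integral {0..1} (\<lambda>x. (u1 x)\<^sup>2) / 2 - integral {0..1} (\<lambda>x. \<bar>u x\<bar> powr p) / p"
proof -
  note c = nls_on_cont[OF sol] nls_on_cont_deriv[OF sol]
  have two: "\<bar>y\<bar> powr 2 = y\<^sup>2" for y :: real by (simp add: powr_numeral)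
  have sq: "(Lp_norm 2 f)\<^sup>2 = integral {0..1} (\<lambda>x. (g x)\<^sup>2)"
    if "continuous_on {0..1} g" "\<And>x. x \<in> {0<..<1} \<Longrightarrow> f x = g x" for f g
  proof -
    have i: "(LINT x:{0<..<1}|lborel. \<bar>f x\<bar> powr 2) = integral {0..1} (\<lambda>x. (g x)\<^sup>2)"
      by (rule set_lebesgue_integral_unit_interval) (use that in \<open>auto intro!: continuous_intros simp: two\<close>)
    have "integral {0..1} (\<lambda>x. (g x)\<^sup>2) \<ge> 0"
      by (intro integral_nonneg integrable_continuous_real continuous_intros that) auto
    then show ?thesis unfolding Lp_norm_def i by (simp add: powr_half_sqrt)
  qed
  show "(Lp_norm 2 u)\<^sup>2 = integral {0..1} (\<lambda>x. (u x)\<^sup>2)" by (rule sq) (use c in auto)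
  have d: "(Lp_norm 2 (deriv u))\<^sup>2 = integral {0..1} (\<lambda>x. (u1 x)\<^sup>2)"
    by (rule sq[OF c(2)]) (use nls_on_deriv[OF sol] DERIV_imp_deriv in blast)
  have cp: "continuous_on {0..1} (\<lambda>x. \<bar>u x\<bar> powr p)"
    using p by (intro continuous_on_abs_powr c) auto
  have i: "(LINT x:{0<..<1}|lborel. \<bar>u x\<bar> powr p) = integral {0..1} (\<lambda>x. \<bar>u x\<bar> powr p)"
    by (rule set_lebesgue_integral_unit_interval[OF cp]) simp
  have "integral {0..1} (\<lambda>x. \<bar>u x\<bar> powr p) \<ge> 0"
    by (intro integral_nonneg integrable_continuous_real cp) auto
  then have "Lp_norm p u powr p = integral {0..1} (\<lambda>x. \<bar>u x\<bar> powr p)"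
    unfolding Lp_norm_def i using p by (simp add: powr_powr)
  then show "energy p u = integral {0..1} (\<lambda>x. (u1 x)\<^sup>2) / 2 - integral {0..1} (\<lambda>x. \<bar>u x\<bar> powr p) / p"
    unfolding energy_def d by simp
qed

lemma neumann_solution_iff_nls_on:
  "neumann_solution p lam u \<longleftrightarrow> (\<exists>u1. nls_on p lam 0 1 u u1 \<and> u1 0 = 0 \<and> u1 1 = 0)"
proof
  assume "neumann_solution p lam u"
  then obtain u' u'' where *: "\<forall>x\<in>{0..1}. (u has_real_derivative u' x) (at x within {0..1})"
    "continuous_on {0..1} u'" "\<forall>x\<in>{0<..<1}. (u' has_real_derivative u'' x) (at x)"
    "\<forall>x\<in>{0<..<1}. u'' x + \<bar>u x\<bar> powr (p - 2) * u x = lam * u x" "u' 0 = 0" "u' 1 = 0"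
    unfolding neumann_solution_def by blast
  have "u'' x = lam * u x - \<bar>u x\<bar> powr (p - 2) * u x" if "x \<in> {0<..<1}" for x
    using *(4) that by (simp add: eq_diff_eq)
  then have "nls_on p lam 0 1 u u'" unfolding nls_on_def using *(1,2,3) by simp
  then show "\<exists>u1. nls_on p lam 0 1 u u1 \<and> u1 0 = 0 \<and> u1 1 = 0" using * by blast
next
  assume "\<exists>u1. nls_on p lam 0 1 u u1 \<and> u1 0 = 0 \<and> u1 1 = 0"
  then obtain u1 where "nls_on p lam 0 1 u u1" "u1 0 = 0" "u1 1 = 0" by blast
  then show "neumann_solution p lam u"
    unfolding neumann_solution_def nls_on_def
    by (intro exI[of _ u1] exI[of _ "\<lambda>x. lam * u x - \<bar>u x\<bar> powr (p - 2) * u x"]) simp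
qed

text \<open>
  What the energy comparison needs to know about a solution with \<open>k\<close> zeros, normalized to be positive
  at \<open>0\<close>; \<open>h\<close> is its Hamiltonian. The zero at \<open>3/(2 k)\<close> is recorded to recognize \<open>k = 1\<close> from the
  number of zeros.
\<close>

definition nodal_profile ::
    "real \<Rightarrow> real \<Rightarrow> nat \<Rightarrow> real \<Rightarrow> real \<Rightarrow> (real \<Rightarrow> real) \<Rightarrow> (real \<Rightarrow> real) \<Rightarrow> bool" where
  "nodal_profile p \<mu> k lam h u u1 \<longleftrightarrow>
     k \<ge> 1 \<and> h > 0 \<and> nls_on p lam 0 1 u u1 \<and> u1 0 = 0 \<and> u (1 / (2 * real k)) = 0 \<and>
     (\<forall>x\<in>{0..<1 / (2 * real k)}. u x > 0) \<and>
     (\<forall>x\<in>{0..1}. (u1 x)\<^sup>2 / 2 + \<bar>u x\<bar> powr p / p - lam / 2 * (u x)\<^sup>2 = h) \<and>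
     2 * real k * integral {0..1 / (2 * real k)} (\<lambda>x. (u x)\<^sup>2) = \<mu> \<and>
     (\<forall>t\<in>{0..1 / (2 * real k)}. u (1 / (2 * real k) + t) = - u (1 / (2 * real k) - t)) \<and>
     (k \<ge> 2 \<longrightarrow> u (3 / (2 * real k)) = 0)"

definition quarter_energy :: "real \<Rightarrow> real \<Rightarrow> (real \<Rightarrow> real) \<Rightarrow> (real \<Rightarrow> real) \<Rightarrow> real" where
  "quarter_energy p l u u1 = integral {0..l} (\<lambda>x. (u1 x)\<^sup>2 / 2 - \<bar>u x\<bar> powr p / p)"

text \<open>
  A nodal solution does not vanish at \<open>0\<close>, where its derivative does, so it can be normalized by a sign.
\<close>

lemma nodal_solution_profile:
  assumes p: "p > 2" and v: "v \<in> nodal_normalized_solutions p \<mu>"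
  obtains s lam h :: real and k :: nat and u u1 where
    "s = 1 \<or> s = -1" "\<forall>x. v x = s * u x" "nodal_profile p \<mu> k lam h u u1"
    "energy p v = 2 * real k * quarter_energy p (1 / (2 * real k)) u u1"
proof -
  have nodal: "sign_changing v" "\<exists>lam. neumann_solution p lam v" and mass: "(Lp_norm 2 v)\<^sup>2 = \<mu>"
    using v by (simp_all add: nodal_normalized_solutions_def)
  obtain lam v1 where sol: "nls_on p lam 0 1 v v1" and bc: "v1 0 = 0" "v1 1 = 0"
    using nodal(2) neumann_solution_iff_nls_on by metis
  obtain x y where x: "x \<in> {0<..<1}" "v x > 0" and y: "y \<in> {0<..<1}" "v y < 0"
    using nodal(1) unfolding sign_changing_def by metis
  have v0: "v 0 \<noteq> 0"
  proof
    assume "v 0 = 0"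
    then have "v (0 + 1 * x) = (-1) * v (0 + 1 * x)"
      using nls_propagate[OF p sol, of 1 1 "-1" 0 0 x] bc x by simp
    then show False using x by simp
  qed
  define s :: real where "s = (if v 0 > 0 then 1 else -1)"
  have s: "s = 1 \<or> s = -1" by (simp add: s_def)
  define u u1 where "u = (\<lambda>t. s * v (0 + 1 * t))" and "u1 = (\<lambda>t. s * 1 * v1 (0 + 1 * t))"
  have vu: "\<forall>t. v t = s * u t" using s by (auto simp: u_def)
  have usol: "nls_on p lam 0 1 u u1"
    unfolding u_def u1_def by (rule nls_on_symmetry[OF sol _ s]) auto
  have ubc: "u1 0 = 0" "u1 1 = 0" using bc by (simp_all add: u1_def)
  have u0: "u 0 > 0" using v0 by (auto simp: u_def s_def)
  obtain y' where y': "y' \<in> {0..1}" "u y' < 0"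
  proof (cases "v 0 > 0")
    case True
    then show ?thesis using that[of y] y by (simp add: u_def s_def)
  next
    case False
    then show ?thesis using that[of x] x by (simp add: u_def s_def)
  qed
  obtain z h :: real and k :: nat where k: "k \<ge> 1" "z > 0" "2 * real k * z = 1" "h > 0" "u z = 0"
    and upos: "\<forall>x\<in>{0..<z}. u x > 0"
    and ham: "\<forall>x\<in>{0..1}. (u1 x)\<^sup>2 / 2 + \<bar>u x\<bar> powr p / p - lam / 2 * (u x)\<^sup>2 = h"
    and odd_z: "\<forall>t\<in>{0..z}. u (z + t) = - u (z - t) \<and> u1 (z + t) = u1 (z - t)"
    and shift: "\<forall>t\<in>{0..1 - 2 * z}. u (2 * z + t) = - u t \<and> u1 (2 * z + t) = - u1 t"
    by (rule nodal_structure[OF p usol ubc u0 y']) blast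
  have z: "z = 1 / (2 * real k)" using k by (simp add: field_simps)
  note c = nls_on_cont[OF usol] nls_on_cont_deriv[OF usol]
  have I: "integral {0..1} (\<lambda>x. (u x)\<^sup>2) = 2 * real k * integral {0..z} (\<lambda>x. (u x)\<^sup>2)"
    by (rule integral_periodic_pieces[OF _ k(2,3)])
       (use odd_z shift in \<open>auto intro!: continuous_intros c\<close>)
  have Iu1: "integral {0..1} (\<lambda>x. (u1 x)\<^sup>2) = 2 * real k * integral {0..z} (\<lambda>x. (u1 x)\<^sup>2)"
    by (rule integral_periodic_pieces[OF _ k(2,3)])
       (use odd_z shift in \<open>auto intro!: continuous_intros c\<close>)
  have cp: "continuous_on {0..1} (\<lambda>x. \<bar>u x\<bar> powr p)"
    using p by (intro continuous_on_abs_powr c) auto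
  have Ip: "integral {0..1} (\<lambda>x. \<bar>u x\<bar> powr p) = 2 * real k * integral {0..z} (\<lambda>x. \<bar>u x\<bar> powr p)"
    by (rule integral_periodic_pieces[OF cp k(2,3)]) (use odd_z shift in auto)
  have "integral {0..1} (\<lambda>x. (u x)\<^sup>2) = integral {0..1} (\<lambda>x. (v x)\<^sup>2)"
    using s by (intro integral_cong) (auto simp: vu)
  then have mass': "2 * real k * integral {0..z} (\<lambda>x. (u x)\<^sup>2) = \<mu>"
    using I mass nls_on_norms(1)[OF p sol] by simp
  have z1: "z \<le> 1"
    using k(1-3) mult_right_mono[of 1 "real k" "2 * z"] by (simp add: mult_ac)
  have int: "(\<lambda>x. (u1 x)\<^sup>2) integrable_on {0..z}" "(\<lambda>x. \<bar>u x\<bar> powr p) integrable_on {0..z}"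
    using z1 by (auto intro!: integrable_continuous_real continuous_intros continuous_on_subset[OF c(2)]
        continuous_on_subset[OF cp])
  have "energy p v = integral {0..1} (\<lambda>x. (u1 x)\<^sup>2) / 2 - integral {0..1} (\<lambda>x. \<bar>u x\<bar> powr p) / p"
  proof -
    have "integral {0..1} (\<lambda>x. (u1 x)\<^sup>2) = integral {0..1} (\<lambda>x. (v1 x)\<^sup>2)"
      using s by (intro integral_cong) (auto simp: u1_def)
    moreover have "integral {0..1} (\<lambda>x. \<bar>u x\<bar> powr p) = integral {0..1} (\<lambda>x. \<bar>v x\<bar> powr p)"
      using s by (intro integral_cong) (auto simp: u_def)
    ultimately show ?thesis using nls_on_norms(2)[OF p sol] by simp
  qed
  also have "\<dots> = 2 * real k * quarter_energy p z u u1"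
    unfolding quarter_energy_def Iu1 Ip
    using int by (simp add: integral_diff integrable_on_divide right_diff_distrib)
  finally have en: "energy p v = 2 * real k * quarter_energy p z u u1" .
  have "u (3 / (2 * real k)) = 0" if "k \<ge> 2"
  proof -
    have "2 * (2 * z) \<le> 1"
      using k(2,3) that mult_right_mono[of 2 "real k" "2 * z"] by (simp add: mult_ac)
    then have "u (2 * z + z) = - u z" using bspec[OF shift, of z] k(2) by auto
    moreover have "2 * z + z = 3 / (2 * real k)" unfolding z by (simp add: field_simps)
    ultimately show ?thesis using k(5) by simp
  qed
  then have "nodal_profile p \<mu> k lam h u u1"
    unfolding nodal_profile_def z[symmetric] using k usol ubc upos ham mass' odd_z by auto
  then show ?thesis using that[OF s vu] en unfolding z by blast
qed

text \<open>
  Stretching the quarter wave of \<open>v\<close> by the factor \<open>k\<close> gives an admissible competitor \<open>V\<close> on \<open>[0, 1/2]\<close>.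
  The energy saved is the gradient part \<open>J (k^2 - 1)/(2 k)\<close>, where \<open>J = \<integral> v'^2 > 0\<close>; so equality leaves
  only \<open>k = 1\<close>, where \<open>quarter_wave_comparison\<close> and oddness about \<open>1/2\<close> identify \<open>v\<close> with \<open>u\<close>.
\<close>

lemma quarter_energy_minimal:
  assumes p: "2 < p" "p < 6"
    and u: "nodal_profile p \<mu> 1 lam h u u1" and v: "nodal_profile p \<mu> k lam' h' v v1"
  shows "2 * quarter_energy p (1/2) u u1 \<le> 2 * real k * quarter_energy p (1 / (2 * real k)) v v1"
    and "2 * quarter_energy p (1/2) u u1 = 2 * real k * quarter_energy p (1 / (2 * real k)) v v1 \<Longrightarrow>
         x \<in> {0..1} \<Longrightarrow> v x = u x"
proof -
  define K where "K = real k"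
  define z where "z = 1 / (2 * K)"
  have k: "k \<ge> 1" using v by (simp add: nodal_profile_def)
  then have K: "K \<ge> 1" by (simp add: K_def)
  have z: "z > 0" "z \<le> 1 / 2" using K by (auto simp: z_def field_simps)
  have usol: "nls_on p lam 0 1 u u1" and u10: "u1 0 = 0" and ul: "u (1/2) = 0" and h: "h > 0"
    and upos: "\<And>x. x \<in> {0..<1/2} \<Longrightarrow> u x > 0"
    and ham: "\<And>x. x \<in> {0..1} \<Longrightarrow> (u1 x)\<^sup>2 / 2 + \<bar>u x\<bar> powr p / p - lam / 2 * (u x)\<^sup>2 = h"
    and umass: "2 * integral {0..1/2} (\<lambda>x. (u x)\<^sup>2) = \<mu>"
    and uodd: "\<And>t. t \<in> {0..1/2} \<Longrightarrow> u (1/2 + t) = - u (1/2 - t)"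
    using u by (auto simp: nodal_profile_def)
  have vsol: "nls_on p lam' 0 1 v v1" and vl: "v z = 0" and h': "h' > 0"
    and vpos: "\<And>x. x \<in> {0..<z} \<Longrightarrow> v x > 0"
    and vham: "\<And>x. x \<in> {0..1} \<Longrightarrow> (v1 x)\<^sup>2 / 2 + \<bar>v x\<bar> powr p / p - lam' / 2 * (v x)\<^sup>2 = h'"
    and vmass: "2 * K * integral {0..z} (\<lambda>x. (v x)\<^sup>2) = \<mu>"
    and vodd: "\<And>t. t \<in> {0..z} \<Longrightarrow> v (z + t) = - v (z - t)"
    using v by (auto simp: nodal_profile_def z_def K_def)
  note cv = nls_on_cont[OF vsol] nls_on_cont_deriv[OF vsol]
  have usol': "nls_on p lam 0 (1/2) u u1"
    using nls_on_symmetry[OF usol, of 1 1 0 "1/2" 0] by simp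
  have rescale: "integral {0..1/2} (\<lambda>x. f (x / K)) = K * integral {0..z} f"
    if "continuous_on {0..z} f" for f :: "real \<Rightarrow> real"
  proof -
    have "(f has_integral integral {0..z} f) {0..z}"
      using that by (intro integrable_integral integrable_continuous_real)
    from has_integral_stretch_real[OF this, of "1 / K"]
    have "((\<lambda>x. f (x / K)) has_integral K * integral {0..z} f) ((\<lambda>x. x * K) ` {0..z})"
      using K by simp
    moreover have "(\<lambda>x. x * K) ` {0..z} = {0..1/2}"
      using K z image_mult_atLeastAtMost[of K 0 z] by (simp add: mult.commute z_def)
    ultimately show ?thesis by (simp add: integral_unique)
  qed
  define V V1 where "V = (\<lambda>x. v (x / K))" and "V1 = (\<lambda>x. v1 (x / K) / K)"
  have le: "x / K \<in> {0..1}" if "x \<in> {0..1/2}" for x using that K by (auto simp: field_simps)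
  have dV: "(V has_real_derivative V1 x) (at x within {0..1/2})" if x: "x \<in> {0..1/2}" for x
  proof -
    have "(v has_real_derivative v1 (x / K)) (at (x / K) within {0..1})"
      using nls_on_deriv_within[OF vsol le[OF x]] .
    then have "(v has_real_derivative v1 (x / K)) (at (x / K) within (\<lambda>x. x / K) ` {0..1/2})"
      by (rule DERIV_subset) (use le in auto)
    moreover have "((\<lambda>x. x / K) has_real_derivative 1 / K) (at x within {0..1/2})"
      using K by (auto intro!: derivative_eq_intros)
    ultimately have "(v \<circ> (\<lambda>x. x / K) has_real_derivative v1 (x / K) * (1 / K)) (at x within {0..1/2})"
      by (rule DERIV_image_chain)
    then show ?thesis by (simp add: V_def V1_def o_def)
  qed
  have cV1: "continuous_on {0..1/2} V1"
    unfolding V1_def using K le by (intro continuous_intros continuous_on_compose2[OF cv(2)]) auto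
  have Vpos: "V x > 0" if "x \<in> {0..<1/2}" for x
    using vpos[of "x / K"] that K by (simp add: V_def z_def field_simps)
  have Vl: "V (1/2) = 0" using vl by (simp add: V_def z_def)
  have sub: "{0..z} \<subseteq> {0..1}" using z by auto
  note cvz = continuous_on_subset[OF cv(1) sub] continuous_on_subset[OF cv(2) sub]
  have Vmass: "integral {0..1/2} (\<lambda>x. (V x)\<^sup>2) = integral {0..1/2} (\<lambda>x. (u x)\<^sup>2)"
    using rescale[of "\<lambda>x. (v x)\<^sup>2"] umass vmass by (simp add: V_def continuous_intros cvz)
  note cmp = quarter_wave_comparison[OF p _ usol' u10 upos ul h ham dV cV1 Vpos Vl Vmass]
  have A: "integral {0..1/2} (\<lambda>x. (u1 x)\<^sup>2 / 2 - \<bar>u x\<bar> powr p / p) \<le>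
      integral {0..1/2} (\<lambda>x. (V1 x)\<^sup>2 / 2 - \<bar>V x\<bar> powr p / p)"
    by (rule cmp(1)) auto
  define J where "J = integral {0..z} (\<lambda>x. (v1 x)\<^sup>2)"
  define P where "P = integral {0..z} (\<lambda>x. \<bar>v x\<bar> powr p)"
  have cp: "continuous_on {0..z} (\<lambda>x. \<bar>v x\<bar> powr p)"
    using p by (intro continuous_on_abs_powr cvz) auto
  have cs: "continuous_on {0..z} (\<lambda>x. (v1 x)\<^sup>2)" by (intro continuous_intros cvz)
  have int: "(\<lambda>x. (v1 x)\<^sup>2) integrable_on {0..z}" "(\<lambda>x. \<bar>v x\<bar> powr p) integrable_on {0..z}"
    using cs cp by (auto intro: integrable_continuous_real)
  have qv: "quarter_energy p z v v1 = J / 2 - P / p"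
    unfolding quarter_energy_def J_def P_def using int by (simp add: integral_diff integrable_on_divide)
  have qV: "integral {0..1/2} (\<lambda>x. (V1 x)\<^sup>2 / 2 - \<bar>V x\<bar> powr p / p) = K * (J / K\<^sup>2 / 2 - P / p)"
  proof -
    have "integral {0..1/2} (\<lambda>x. (V1 x)\<^sup>2 / 2 - \<bar>V x\<bar> powr p / p)
        = K * integral {0..z} (\<lambda>x. (v1 x)\<^sup>2 / K\<^sup>2 / 2 - \<bar>v x\<bar> powr p / p)"
      using rescale[of "\<lambda>x. (v1 x)\<^sup>2 / K\<^sup>2 / 2 - \<bar>v x\<bar> powr p / p"] K p
      by (simp add: V_def V1_def power_divide continuous_intros cs cp)
    also have "integral {0..z} (\<lambda>x. (v1 x)\<^sup>2 / K\<^sup>2 / 2 - \<bar>v x\<bar> powr p / p) = J / K\<^sup>2 / 2 - P / p"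
      unfolding J_def P_def using int by (simp add: integral_diff integrable_on_divide)
    finally show ?thesis .
  qed
  have v1z: "v1 z \<noteq> 0" using vham[of z] z vl h' by auto
  have J: "J > 0"
  proof -
    have "J \<ge> 0" unfolding J_def by (intro integral_nonneg int) auto
    moreover have "J \<noteq> 0"
      unfolding J_def using integral_eq_0_iff[OF cs z(1)] v1z z by auto
    ultimately show ?thesis by simp
  qed
  have diff: "K * (J / 2 - P / p) - K * (J / K\<^sup>2 / 2 - P / p) = J * (K\<^sup>2 - 1) / (2 * K)"
    using K by (simp add: field_simps power2_eq_square)
  have "K\<^sup>2 \<ge> 1" using K by (simp add: one_le_power)
  then have D: "J * (K\<^sup>2 - 1) / (2 * K) \<ge> 0" using J K by simp
  have goal_eq: "2 * real k * quarter_energy p (1 / (2 * real k)) v v1 = 2 * (K * (J / 2 - P / p))"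
    using qv by (simp add: z_def K_def)
  show "2 * quarter_energy p (1/2) u u1 \<le> 2 * real k * quarter_energy p (1 / (2 * real k)) v v1"
    unfolding goal_eq using A D diff unfolding qV by (simp add: quarter_energy_def)
  assume "2 * quarter_energy p (1/2) u u1 = 2 * real k * quarter_energy p (1 / (2 * real k)) v v1"
    and x: "x \<in> {0..1}"
  then have eq: "integral {0..1/2} (\<lambda>x. (u1 x)\<^sup>2 / 2 - \<bar>u x\<bar> powr p / p) = K * (J / 2 - P / p)"
    unfolding goal_eq by (simp add: quarter_energy_def)
  then have "J * (K\<^sup>2 - 1) / (2 * K) = 0" using A D diff unfolding qV by linarith
  then have K1: "K = 1" using J K by (auto simp: power2_eq_1_iff)
  have half: "v t = u t" if "t \<in> {0..1/2}" for t
  proof -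
    have "V t = u t"
      by (rule cmp(2)) (use eq diff K1 that in \<open>auto simp: qV\<close>)
    then show ?thesis using K1 by (simp add: V_def)
  qed
  have z2: "z = 1/2" using K1 by (simp add: z_def)
  show "v x = u x"
  proof (cases "x \<le> 1/2")
    case True
    then show ?thesis using half x by simp
  next
    case False
    then show ?thesis using vodd[of "x - 1/2"] uodd[of "x - 1/2"] half[of "1 - x"] x z2 by simp
  qed
qed

theorem theorem1p4:
  fixes p \<mu> :: real
  assumes "2 < p" and "p < 6" and "\<mu> > 0"
  shows "\<exists>u. least_energy_nodal_normalized_solution p \<mu> u \<and>
           (\<forall>v. least_energy_nodal_normalized_solution p \<mu> v \<longrightarrow> equal_up_to_phase u v)"
proof -
  note p = assms(1,2)
  obtain lam0 w w1 z0 where w: "nls_on p lam0 0 1 w w1" "w1 0 = 0" "w1 1 = 0" "w 0 > 0" "w 1 < 0"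
    and z0: "\<forall>x\<in>{0..1}. w x = 0 \<longrightarrow> x = z0"
    and mass: "integral {0..1} (\<lambda>x. (w x)\<^sup>2) = \<mu>"
    by (rule nodal_solution_exists[OF assms]) blast
  have wN: "w \<in> nodal_normalized_solutions p \<mu>"
  proof -
    have c: "continuous_on {0..1} w" by (rule nls_on_cont[OF w(1)])
    have "\<exists>x\<in>{0<..<1}. w x > 0"
    proof (rule ccontr)
      assume n: "\<not> ?thesis"
      have "closure {0<..<1::real} = {0..1}" by (simp add: closure_greaterThanLessThan)
      then have "w 0 \<le> 0"
        using continuous_le_on_closure[of "{0<..<1}" w 0 0] c n by (auto simp: not_less)
      then show False using w by simp
    qed
    moreover have "\<exists>x\<in>{0<..<1}. w x < 0"
    proof (rule ccontr)
      assume n: "\<not> ?thesis"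
      have "closure {0<..<1::real} = {0..1}" by (simp add: closure_greaterThanLessThan)
      then have "w 1 \<ge> 0"
        using continuous_ge_on_closure[of "{0<..<1}" w 1 0] c n by (auto simp: not_less)
      then show False using w by simp
    qed
    moreover have "\<exists>lam. neumann_solution p lam w"
      unfolding neumann_solution_iff_nls_on using w by blast
    ultimately show ?thesis
      using nls_on_norms(1)[OF p(1) w(1)] mass
      by (simp add: nodal_normalized_solutions_def sign_changing_def)
  qed
  obtain s lam h :: real and k :: nat and u u1 where s: "s = 1 \<or> s = -1" and wu: "\<forall>x. w x = s * u x"
    and q: "nodal_profile p \<mu> k lam h u u1" and en: "energy p w = 2 * real k * quarter_energy p (1 / (2 * real k)) u u1"
    by (rule nodal_solution_profile[OF p(1) wN]) blast
  have k1: "k = 1"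
  proof (rule ccontr)
    assume "k \<noteq> 1"
    then have k2: "k \<ge> 2" using q by (auto simp: nodal_profile_def)
    then have "u (1 / (2 * real k)) = 0" "u (3 / (2 * real k)) = 0" using q by (auto simp: nodal_profile_def)
    then have "1 / (2 * real k) = z0" "3 / (2 * real k) = z0"
      using z0 wu k2 by (auto simp: field_simps)
    then show False using k2 by (simp add: field_simps)
  qed
  have cmp: "energy p w \<le> energy p v \<and> (energy p v = energy p w \<longrightarrow> equal_up_to_phase w v)"
    if v: "v \<in> nodal_normalized_solutions p \<mu>" for v
  proof -
    obtain s' lam' h' :: real and k' :: nat and u' u1' where s': "s' = 1 \<or> s' = -1"
      and vu: "\<forall>x. v x = s' * u' x" and q': "nodal_profile p \<mu> k' lam' h' u' u1'"
      and en': "energy p v = 2 * real k' * quarter_energy p (1 / (2 * real k')) u' u1'"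
      by (rule nodal_solution_profile[OF p(1) v]) blast
    note m = quarter_energy_minimal[OF p q[unfolded k1] q']
    have E: "energy p w = 2 * quarter_energy p (1/2) u u1" using en k1 by simp
    have "equal_up_to_phase w v" if "energy p v = energy p w"
    proof -
      have "u' x = u x" if "x \<in> {0..1}" for x
        using m(2)[OF _ that] E en' \<open>energy p v = energy p w\<close> by simp
      then have "\<forall>x\<in>{0..1}. complex_of_real (v x) = complex_of_real (s * s') * complex_of_real (w x)"
        using s s' by (auto simp: vu wu)
      moreover have "norm (complex_of_real (s * s')) = 1" using s s' by auto
      ultimately show ?thesis unfolding equal_up_to_phase_def by blast
    qed
    then show ?thesis using m(1) E en' by simp
  qed
  have least: "(INF v\<in>nodal_normalized_solutions p \<mu>. ereal (energy p v)) = ereal (energy p w)"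
    by (intro antisym INF_lower2[OF wN] INF_greatest) (use cmp in auto)
  show ?thesis
    using wN cmp unfolding least_energy_nodal_normalized_solution_def least
    by (intro exI[of _ w]) auto
qed


end
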